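(* Let $N\ge 1$ and let $m_1,\dots,m_N$ be distinct positive integers; put $\gamma=\min_j m_j$, $\Gamma=\max_j m_j$, and $\theta_{m}(x)=1/(x+m)$. For $s\ge 0$ define the bounded linear operator $L_s$ on $C[0,\gamma^{-1}]$ by $$(L_s w)(x)=\sum_{j=1}^N |\theta_{m_j}'(x)|^s\, w(\theta_{m_j}(x))=\sum_{j=1}^N (x+m_j)^{-2s}\, w\big(\tfrac{1}{x+m_j}\big),\qquad x\in[0,\gamma^{-1}].$$ Then for all $s>0$, $L_s$ has a strictly positive eigenfunction $v_s$, unique up to multiplication by a positive constant, with $L_s v_s=\lambda_s v_s$, where $\lambda_s>0$ and $\lambda_s=r(L_s)$ is the spectral radius of $L_s$. The map $s\mapsto \lambda_s$ is strictly decreasing and continuous, and for every integer $p\ge 1$ and every $x\in[0,\gamma^{-1}]$, $$(2s)(2s+1)\cdots(2s+p-1)\,(2\gamma^{-1}+\Gamma)^{-p}\le (-1)^p\frac{D^p v_s(x)}{v_s(x)}\le (2s)(2s+1)\cdots(2s+p-1)\,\gamma^{-p},$$ where $D^p$ denotes the $p$-th derivative. Finally, the Hausdorff dimension of the invariant set $E$ of the maps $\theta_{m_1},\dots,\theta_{m_N}$ is the unique value of $s$ with $\lambda_s=1$.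
   Context: Each $\theta_{m_j}$ maps $[0,\gamma^{-1}]$ into itself. The invariant set $E$ is the unique nonempty compact set $E\subset[0,1]$ with $E=\bigcup_{j=1}^N\theta_{m_j}(E)$; equivalently it is the set of points of $[0,1]$ whose continued fraction expansion $[a_1,a_2,\dots]$ has all partial quotients $a_i\in\{m_1,\dots,m_N\}$ (the set of limit points of $\theta_{m_{i_1}}\circ\cdots\circ\theta_{m_{i_n}}(0)$). A function is strictly positive if it is $>0$ everywhere on its domain. *)

theory Defs
  imports "HOL-Analysis.Analysis"
begin

section \<open>The Banach space of continuous functions on a compact set\<close>

text \<open>
  An element of $C(K)$ is represented by the function on the whole real line that vanishes outside
  \<open>K\<close>. Equality in $C(K)$ is thus equality of functions, and $C(K)$ is closed under the pointwise
  operations. The scalar field is \<open>real\<close> or \<open>complex\<close>.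
\<close>

definition cont_space :: "real set \<Rightarrow> (real \<Rightarrow> 'a::real_normed_field) set" where
  "cont_space K = {w. continuous_on K w \<and> (\<forall>x. x \<notin> K \<longrightarrow> w x = 0)}"

definition sup_norm_on :: "real set \<Rightarrow> (real \<Rightarrow> 'a::real_normed_field) \<Rightarrow> real" where
  "sup_norm_on K w = (SUP x\<in>K. norm (w x))"

definition bounded_op :: "real set \<Rightarrow> ((real \<Rightarrow> 'a::real_normed_field) \<Rightarrow> real \<Rightarrow> 'a) \<Rightarrow> bool" where
  "bounded_op K T \<longleftrightarrow>
     (\<forall>w\<in>cont_space K. T w \<in> cont_space K) \<and>
     (\<forall>w\<in>cont_space K. \<forall>u\<in>cont_space K. T (\<lambda>x. w x + u x) = (\<lambda>x. T w x + T u x)) \<and>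
     (\<forall>c. \<forall>w\<in>cont_space K. T (\<lambda>x. c * w x) = (\<lambda>x. c * T w x)) \<and>
     (\<exists>B. \<forall>w\<in>cont_space K. sup_norm_on K (T w) \<le> B * sup_norm_on K w)"

text \<open>
  The spectrum is taken over the complex numbers. For an operator on the real space it is,
  as usual, that of the complexification; for the transfer operators below the complexification
  is given by the same formula on complex-valued functions.
\<close>

definition op_spectrum :: "real set \<Rightarrow> ((real \<Rightarrow> complex) \<Rightarrow> real \<Rightarrow> complex) \<Rightarrow> complex set" where
  "op_spectrum K T =
     {z. \<not> (\<exists>R. bounded_op K R \<and>
              (\<forall>w\<in>cont_space K. R (\<lambda>x. z * w x - T w x) = w \<and>
                                (\<lambda>x. z * R w x - T (R w) x) = w))}"

definition op_spectral_radius :: "real set \<Rightarrow> ((real \<Rightarrow> complex) \<Rightarrow> real \<Rightarrow> complex) \<Rightarrow> real" where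
  "op_spectral_radius K T = (SUP z\<in>op_spectrum K T. cmod z)"


section \<open>Iterated derivatives on a set\<close>

text \<open>
  Derivatives are taken within \<open>K\<close>, hence one-sided at the end points of an interval. The value
  is meaningful only where the derivative exists.
\<close>

definition iter_deriv_on :: "real set \<Rightarrow> nat \<Rightarrow> (real \<Rightarrow> real) \<Rightarrow> real \<Rightarrow> real" where
  "iter_deriv_on K p f = ((\<lambda>g x. vector_derivative g (at x within K)) ^^ p) f"


section \<open>Hausdorff dimension\<close>

text \<open>
  The usual convention for \<open>d = 0\<close>: nonempty sets contribute 1 and the empty set contributes 0
  (whereas \<open>0 powr 0 = 0\<close>).
\<close>

definition diam_power :: "real \<Rightarrow> 'a::metric_space set \<Rightarrow> ennreal" where
  "diam_power d U = (if U = {} then 0 else if d = 0 then 1 else ennreal (diameter U powr d))"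

definition hausdorff_content_upto :: "real \<Rightarrow> real \<Rightarrow> 'a::metric_space set \<Rightarrow> ennreal" where
  "hausdorff_content_upto d \<delta> A =
     (INF U \<in> {U :: nat \<Rightarrow> 'a set. A \<subseteq> (\<Union>i. U i) \<and> (\<forall>i. bounded (U i) \<and> diameter (U i) \<le> \<delta>)}.
        (\<Sum>i. diam_power d (U i)))"

definition hausdorff_measure :: "real \<Rightarrow> 'a::metric_space set \<Rightarrow> ennreal" where
  "hausdorff_measure d A = (SUP \<delta>\<in>{0<..}. hausdorff_content_upto d \<delta> A)"

definition hausdorff_dim :: "'a::metric_space set \<Rightarrow> ennreal" where
  "hausdorff_dim A = (INF d\<in>{d. 0 \<le> d \<and> hausdorff_measure d A = 0}. ennreal d)"


section \<open>Continued fraction maps and their transfer operators\<close>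

definition theta :: "nat \<Rightarrow> real \<Rightarrow> real" where
  "theta k x = 1 / (x + real k)"

definition gamma_min :: "nat \<Rightarrow> (nat \<Rightarrow> nat) \<Rightarrow> nat" where
  "gamma_min N m = Min (m ` {1..N})"

definition Gamma_max :: "nat \<Rightarrow> (nat \<Rightarrow> nat) \<Rightarrow> nat" where
  "Gamma_max N m = Max (m ` {1..N})"

definition dom_interval :: "nat \<Rightarrow> (nat \<Rightarrow> nat) \<Rightarrow> real set" where
  "dom_interval N m = {0..1 / real (gamma_min N m)}"

definition transfer_op ::
    "nat \<Rightarrow> (nat \<Rightarrow> nat) \<Rightarrow> real \<Rightarrow> (real \<Rightarrow> 'a::real_normed_field) \<Rightarrow> real \<Rightarrow> 'a" where
  "transfer_op N m s w x =
     (if x \<in> dom_interval N m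
      then \<Sum>j=1..N. (\<bar>deriv (theta (m j)) x\<bar> powr s) *\<^sub>R w (theta (m j) x)
      else 0)"

definition transfer_radius :: "nat \<Rightarrow> (nat \<Rightarrow> nat) \<Rightarrow> real \<Rightarrow> real" where
  "transfer_radius N m s = op_spectral_radius (dom_interval N m) (transfer_op N m s)"

definition is_invariant_set :: "nat \<Rightarrow> (nat \<Rightarrow> nat) \<Rightarrow> real set \<Rightarrow> bool" where
  "is_invariant_set N m E \<longleftrightarrow>
     E \<noteq> {} \<and> compact E \<and> E \<subseteq> {0..1} \<and> E = (\<Union>j\<in>{1..N}. theta (m j) ` E)"

definition invariant_set :: "nat \<Rightarrow> (nat \<Rightarrow> nat) \<Rightarrow> real set" where
  "invariant_set N m = (THE E. is_invariant_set N m E)"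

lemma deriv_theta:
  assumes "x \<ge> 0" "k > 0"
  shows "deriv (theta k) x = - 1 / (x + real k)\<^sup>2"
proof -
  have "x + real k \<noteq> 0" using assms by linarith
  then have "((\<lambda>x. 1 / (x + real k)) has_real_derivative - 1 / (x + real k)\<^sup>2) (at x)"
    by (auto intro!: derivative_eq_intros simp: power2_eq_square)
  moreover have "theta k = (\<lambda>x. 1 / (x + real k))" by (simp add: theta_def fun_eq_iff)
  ultimately show ?thesis by (simp add: DERIV_imp_deriv)
qed

lemma transfer_op_explicit:
  assumes "\<forall>j\<in>{1..N}. m j > 0" "x \<in> dom_interval N m"
  shows "transfer_op N m s w x =
    (\<Sum>j=1..N. ((x + real (m j)) powr (- 2 * s)) *\<^sub>R w (1 / (x + real (m j))))"
proof -
  have "\<bar>deriv (theta (m j)) x\<bar> powr s = (x + real (m j)) powr (- 2 * s)" if "j \<in> {1..N}" for j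
  proof -
    have x: "x \<ge> 0" using assms(2) by (simp add: dom_interval_def)
    have mj: "m j > 0" using assms(1) that by blast
    have pos: "x + real (m j) > 0" using x mj by linarith
    have "\<bar>deriv (theta (m j)) x\<bar> = (x + real (m j)) powr (- 2)"
      using pos by (simp add: deriv_theta[OF x mj] powr_minus field_simps)
    then show ?thesis by (simp add: powr_powr)
  qed
  then show ?thesis using assms(2) by (simp add: transfer_op_def theta_def)
qed

lemma theta_maps_dom_interval:
  assumes "\<forall>j\<in>{1..N}. m j > 0" "j \<in> {1..N}" "x \<in> dom_interval N m"
  shows "theta (m j) x \<in> dom_interval N m"
proof -
  have fin: "finite (m ` {1..N})" "m j \<in> m ` {1..N}" using assms(2) by auto
  have le: "gamma_min N m \<le> m j" unfolding gamma_min_def using fin by (rule Min_le)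
  have "gamma_min N m \<in> m ` {1..N}"
    unfolding gamma_min_def using fin by (intro Min_in) auto
  then have "gamma_min N m > 0" using assms(1) by auto
  moreover have "x \<ge> 0" using assms(3) by (simp add: dom_interval_def)
  ultimately show ?thesis using le
    by (auto simp: dom_interval_def theta_def intro!: divide_left_mono mult_pos_pos)
qed

end

theory Submission
  imports Defs "HOL-Probability.Helly_Selection"
begin

text \<open>
  The \<open>n\<close>-th iterate of the transfer operator on the constant 1 is a sum over words of length \<open>n\<close> of
  \<open>(C x + D) powr (- 2 * s)\<close>, where \<open>C x + D\<close> is the denominator of the Moebius map of the word. Since
  \<open>C x + D\<close> varies by a factor of at most 2, these sums grow like \<open>\<lambda>\<^sup>n\<close> up to a constant factor. Because
  \<open>C / D\<close> is itself a finite continued fraction, weak compactness of measures turns normalised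
  averages of the iterates into an eigenfunction \<open>v x = (\<integral>y. (1 + x y) powr (- 2 * s) \<partial>M)\<close>, and
  differentiating under the integral bounds all its derivatives. A strictly positive eigenfunction
  dominates every function, so the Neumann series converges outside the disc of radius \<open>\<lambda>\<close>, which is
  hence the spectral radius. Monotonicity and continuity in \<open>s\<close> follow from exponential bounds on the
  denominators. For the dimension, covering by cylinders gives the upper bound; for the lower bound,
  every set of a cover is replaced by the smallest cylinder that contains its part of the invariant
  set, and the sum over words at \<open>\<lambda> = 1\<close> bounds the total weight of finitely many covering cylinders
  from below.
\<close>

section \<open>Continued fraction words\<close>

text \<open>The two-sided bound on all derivatives dictates how the eigenfunction is built. A fixed
  point or compactness argument inside C(K) does not by itself control derivatives of every order
  with the constants \<open>Min A\<close> and \<open>2 / Min A + Max A\<close>. A single kernel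
  \<open>(1 + x c) powr (- 2 * s)\<close> does: its p-th derivative divided by the kernel is, up to
  sign, the product of the \<open>2 * s + i\<close> for \<open>i < p\<close> divided by
  \<open>(x + 1 / c) ^ p\<close>. Such bounds survive integration over \<open>c\<close>, so the
  limit is taken among measures in \<open>c\<close> and not among functions. Divided by
  \<open>r ^ n\<close> they stay bounded, because the word sums are multiplicative up to a constant
  factor, and averages of a bounded orbit satisfy the eigenvalue equation up to an error of order
  1/n. No measure on the invariant set is built for the lower bound on the dimension. Compactness
  reduces every cover to a finite one, and counting the extensions of words to a common length takes
  the place of mass.\<close>

fun cf_map :: "nat list \<Rightarrow> real \<Rightarrow> real" where
  "cf_map [] x = x"
| "cf_map (a # w) x = theta a (cf_map w x)"

text \<open>
  \<open>cf_map w\<close> is a Moebius transformation with determinant \<open>\<plusminus>1\<close>, and \<open>cf_den w x\<close> is its denominator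
  \<open>C x + D\<close> at \<open>x\<close>. Hence the derivative of \<open>cf_map w\<close> has modulus \<open>1 / (cf_den w x)\<^sup>2\<close>.
\<close>

fun cf_den :: "nat list \<Rightarrow> real \<Rightarrow> real" where
  "cf_den [] x = 1"
| "cf_den (a # w) x = cf_den w x * (cf_map w x + real a)"

lemma theta_diff:
  assumes "x \<ge> 0" "y \<ge> 0" "a > 0"
  shows "\<bar>theta a x - theta a y\<bar> = \<bar>x - y\<bar> / ((x + real a) * (y + real a))"
proof -
  have "x + real a > 0" "y + real a > 0" using assms by linarith+
  then have "theta a x - theta a y = (y - x) / ((x + real a) * (y + real a))"
    by (simp add: theta_def field_simps)
  then show ?thesis
    using \<open>x + real a > 0\<close> \<open>y + real a > 0\<close> by (simp add: abs_divide abs_mult abs_minus_commute)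
qed

lemma theta_inj:
  assumes "x \<ge> 0" "y \<ge> 0" "a > 0" "theta a x = theta a y"
  shows "x = y"
proof -
  have "x + real a > 0" "y + real a > 0" using assms by linarith+
  then show ?thesis using assms(4) by (simp add: theta_def field_simps)
qed

lemma cf_map_append: "cf_map (u @ w) x = cf_map u (cf_map w x)"
  by (induction u) auto

lemma cf_den_append: "cf_den (u @ w) x = cf_den w x * cf_den u (cf_map w x)"
  by (induction u) (auto simp: cf_map_append)

lemma cf_map_nonneg: "0 \<notin> set w \<Longrightarrow> x \<ge> 0 \<Longrightarrow> cf_map w x \<ge> 0"
  by (induction w) (auto simp: theta_def)

lemma cf_den_ge_1: "0 \<notin> set w \<Longrightarrow> x \<ge> 0 \<Longrightarrow> cf_den w x \<ge> 1"
proof (induction w)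
  case (Cons a w)
  have "cf_map w x \<ge> 0" using Cons.prems cf_map_nonneg by simp
  moreover have "real a \<ge> 1" using Cons.prems by (cases a) auto
  ultimately have "cf_map w x + real a \<ge> 1" by linarith
  then show ?case using Cons mult_mono[of 1 "cf_den w x" 1 "cf_map w x + real a"] by simp
qed simp

lemma cf_den_pos: "0 \<notin> set w \<Longrightarrow> x \<ge> 0 \<Longrightarrow> cf_den w x > 0"
  using cf_den_ge_1[of w x] by linarith

text \<open>
  Reversing the word reads off the ratio \<open>C / D\<close>. Iterates of the transfer operator on the constant
  function 1 are therefore positive combinations of the kernels \<open>(1 + x y) powr (- 2 * s)\<close> with \<open>y\<close>
  in a fixed compact interval.
\<close>

lemma cf_den_eq:
  "0 \<notin> set w \<Longrightarrow> x \<ge> 0 \<Longrightarrow> cf_den w x = cf_den w 0 * (1 + x * cf_map (rev w) 0)"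
\<comment> \<open>Appending a letter to \<open>u\<close> prepends it to \<open>rev u\<close>, so
  induction from the right matches the recursion of \<open>cf_map\<close> on the reversed
  word.\<close>
proof (induction w arbitrary: x rule: rev_induct)
  case (snoc a u)
  have a: "real a \<ge> 1" using snoc.prems by (cases a) auto
  have 0: "0 \<notin> set u" using snoc.prems by simp
  define r where "r = cf_map (rev u) 0"
  have r: "r \<ge> 0" unfolding r_def using 0 by (intro cf_map_nonneg) auto
  have *: "cf_den (u @ [a]) y = cf_den u 0 * (y + real a + r)" if "y \<ge> 0" for y
  proof -
    have "cf_den (u @ [a]) y = (y + real a) * cf_den u (theta a y)"
      by (simp add: cf_den_append)
    also have "cf_den u (theta a y) = cf_den u 0 * (1 + theta a y * r)"
      unfolding r_def using 0 that a by (intro snoc.IH) (auto simp: theta_def)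
    finally have "cf_den (u @ [a]) y = cf_den u 0 * ((y + real a) * (1 + theta a y * r))" by simp
    also have "(y + real a) * (1 + theta a y * r) = y + real a + r"
      using that a by (simp add: theta_def field_simps)
    finally show ?thesis .
  qed
  have "cf_map (rev (u @ [a])) 0 = 1 / (r + real a)" by (simp add: theta_def r_def)
  then have "cf_den (u @ [a]) 0 * (1 + x * cf_map (rev (u @ [a])) 0)
      = cf_den u 0 * ((real a + r) * (1 + x / (r + real a)))"
    using *[of 0] by simp
  also have "(real a + r) * (1 + x / (r + real a)) = x + real a + r"
    using r a by (simp add: field_simps)
  finally show ?case using *[of x] snoc.prems(2) by simp
qed simp

lemma theta_unit: "a > 0 \<Longrightarrow> x \<ge> 0 \<Longrightarrow> theta a x \<in> {0..1}"
  by (cases a) (auto simp: theta_def)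

lemma cf_map_unit: "0 \<notin> set w \<Longrightarrow> x \<in> {0..1} \<Longrightarrow> cf_map w x \<in> {0..1}"
proof (induction w)
  case (Cons a w)
  then have "cf_map w x \<ge> 0" "a > 0" by auto
  then show ?case using theta_unit[of a "cf_map w x"] by simp
qed simp

text \<open>Bounded distortion: \<open>C / D\<close> equals \<open>cf_map (rev w) 0\<close>, which
  lies in \<open>{0..1}\<close>, so \<open>1 + x * C / D\<close> lies between 1 and 2.\<close>

lemma cf_den_le:
  assumes "0 \<notin> set w" "x \<in> {0..1}"
  shows "cf_den w 0 \<le> cf_den w x" "cf_den w x \<le> 2 * cf_den w 0"
proof -
  have "cf_map (rev w) 0 \<in> {0..1}" using assms by (intro cf_map_unit) auto
  then have "0 \<le> x * cf_map (rev w) 0" "x * cf_map (rev w) 0 \<le> 1"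
    using assms mult_mono[of x 1 "cf_map (rev w) 0" 1] by auto
  moreover have pos: "cf_den w 0 > 0" using assms cf_den_pos by simp
  moreover have "cf_den w x = cf_den w 0 * (1 + x * cf_map (rev w) 0)"
    using assms by (intro cf_den_eq) auto
  ultimately show "cf_den w 0 \<le> cf_den w x" "cf_den w x \<le> 2 * cf_den w 0"
    by (simp_all add: mult.commute[of 2])
qed

text \<open>An exact substitute for the mean value theorem, valid because the determinant of the
  Moebius map is 1 or -1. It gives contraction from above as well as separation from below.\<close>

lemma cf_map_diff:
  "0 \<notin> set w \<Longrightarrow> x \<ge> 0 \<Longrightarrow> y \<ge> 0 \<Longrightarrow>
    \<bar>cf_map w x - cf_map w y\<bar> = \<bar>x - y\<bar> / (cf_den w x * cf_den w y)"
proof (induction w)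
  case (Cons a w)
  have "\<bar>cf_map (a # w) x - cf_map (a # w) y\<bar>
      = \<bar>cf_map w x - cf_map w y\<bar> / ((cf_map w x + real a) * (cf_map w y + real a))"
    using Cons.prems by (simp add: theta_diff cf_map_nonneg)
  also have "\<bar>cf_map w x - cf_map w y\<bar> = \<bar>x - y\<bar> / (cf_den w x * cf_den w y)"
    using Cons by simp
  finally show ?case by (simp add: field_simps)
qed simp

text \<open>One letter need not increase the denominator: \<open>cf_den [1] 0 = 1\<close>. Two
  letters multiply it by \<open>1 + a * (cf_map w x + b)\<close>, which is at least 2; hence the
  halved length.\<close>

lemma cf_den_growth:
  "0 \<notin> set w \<Longrightarrow> x \<ge> 0 \<Longrightarrow> cf_den w x \<ge> 2 ^ (length w div 2)"
proof (induction w rule: induct_list012)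
  case (3 a b w)
  have "0 \<notin> set w" "a \<ge> 1" "b \<ge> 1" using 3 by (auto intro: Suc_leI)
  then have ge: "cf_map w x \<ge> 0" "real a \<ge> 1" "real b \<ge> 1" "cf_den w x > 0"
    using 3(4) cf_map_nonneg cf_den_pos by auto
  have "cf_den (a # b # w) x = cf_den w x * (1 + real a * (cf_map w x + real b))"
    using ge by (simp add: theta_def field_simps)
  also have "\<dots> \<ge> cf_den w x * 2"
    using ge mult_mono[of 1 "real a" 1 "cf_map w x + real b"] by (intro mult_left_mono) auto
  finally show ?case using 3 by simp
qed auto

section \<open>Words over a finite digit set and iterates of the transfer operator\<close>

locale digits =
  fixes A :: "nat set"
  assumes fin: "finite A" and ne: "A \<noteq> {}" and not0: "0 \<notin> A"
begin

definition K :: "real set" where "K = {0..1 / real (Min A)}"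

definition words :: "nat \<Rightarrow> nat list set" where
  "words n = {w. set w \<subseteq> A \<and> length w = n}"

text \<open>The derivative factor is already evaluated. The value 0 outside \<open>K\<close> makes
  operator identities hold as equalities of functions on the whole line.\<close>

definition cf_op :: "real \<Rightarrow> (real \<Rightarrow> 'a::real_normed_field) \<Rightarrow> real \<Rightarrow> 'a" where
  "cf_op s f x =
     (if x \<in> K then \<Sum>a\<in>A. ((x + real a) powr (- 2 * s)) *\<^sub>R f (theta a x) else 0)"

lemma Min_ge_1: "Min A \<ge> 1"
  using Min_in[OF fin ne] not0 by (cases "Min A") auto

lemma digit_ge_1: "a \<in> A \<Longrightarrow> real a \<ge> 1"
  using not0 by (cases a) auto

lemma K_unit: "x \<in> K \<Longrightarrow> x \<in> {0..1}"
  using Min_ge_1 order_trans[of x "1 / real (Min A)" 1] by (auto simp: K_def)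

lemma zero_in_K: "0 \<in> K" by (simp add: K_def)

lemma theta_K: "a \<in> A \<Longrightarrow> x \<ge> 0 \<Longrightarrow> theta a x \<in> K"
  using Min_ge_1 Min_le[OF fin, of a] digit_ge_1[of a]
  by (auto simp: K_def theta_def intro!: divide_left_mono mult_pos_pos)

lemma words_0 [simp]: "words 0 = {[]}" by (auto simp: words_def)

lemma words_Suc: "words (Suc n) = (\<lambda>(a, w). a # w) ` (A \<times> words n)"
  by (auto simp: words_def length_Suc_conv image_iff)

lemma finite_words: "finite (words n)"
  unfolding words_def by (rule finite_lists_length_eq[OF fin])

lemma words_not0: "w \<in> words n \<Longrightarrow> 0 \<notin> set w" using not0 by (auto simp: words_def)

lemma length_words: "w \<in> words n \<Longrightarrow> length w = n" by (simp add: words_def)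

lemma sum_words_Suc: "(\<Sum>w\<in>words (Suc n). f w) = (\<Sum>w\<in>words n. \<Sum>a\<in>A. f (a # w))"
proof -
  have "inj_on (\<lambda>(a, w). a # w) (A \<times> words n)" by (auto simp: inj_on_def)
  then have "(\<Sum>w\<in>words (Suc n). f w) = (\<Sum>(a, w)\<in>A \<times> words n. f (a # w))"
    by (simp add: words_Suc sum.reindex case_prod_unfold)
  also have "\<dots> = (\<Sum>a\<in>A. \<Sum>w\<in>words n. f (a # w))" by (simp add: sum.cartesian_product)
  also have "\<dots> = (\<Sum>w\<in>words n. \<Sum>a\<in>A. f (a # w))" by (rule sum.swap)
  finally show ?thesis .
qed

lemma sum_words_add:
  "(\<Sum>w\<in>words (n + k). f w) = (\<Sum>w\<in>words k. \<Sum>u\<in>words n. f (u @ w))"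
proof (induction n arbitrary: f)
  case (Suc n)
  have "(\<Sum>w\<in>words (Suc n + k). f w) = (\<Sum>w\<in>words (n + k). \<Sum>a\<in>A. f (a # w))"
    by (simp add: sum_words_Suc)
  also have "\<dots> = (\<Sum>w\<in>words k. \<Sum>u\<in>words n. \<Sum>a\<in>A. f (a # u @ w))" by (rule Suc.IH)
  finally show ?case by (simp add: sum_words_Suc)
qed simp

lemma cf_map_K: "w \<in> words n \<Longrightarrow> x \<in> K \<Longrightarrow> cf_map w x \<in> K"
proof (induction n arbitrary: w)
  case (Suc n)
  then obtain a u where w: "w = a # u" "a \<in> A" "u \<in> words n" by (auto simp: words_Suc)
  then show ?case using Suc theta_K[of a "cf_map u x"] by (auto simp: K_def)
qed auto

text \<open>The chain rule for the composed maps. The extra application is split off innermost,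
  since the head of a word is the map applied last and its factor is the one that
  \<open>cf_den\<close> adds.\<close>

lemma cf_op_funpow:
  assumes "x \<in> K"
  shows "(cf_op s ^^ n) f x = (\<Sum>w\<in>words n. (cf_den w x powr (- 2 * s)) *\<^sub>R f (cf_map w x))"
proof (induction n arbitrary: f)
  case (Suc n)
  have "(cf_op s ^^ Suc n) f x = (cf_op s ^^ n) (cf_op s f) x" by (simp add: funpow_swap1)
  also have "\<dots> = (\<Sum>w\<in>words n. (cf_den w x powr (- 2 * s)) *\<^sub>R cf_op s f (cf_map w x))"
    by (rule Suc)
  also have "\<dots> = (\<Sum>w\<in>words n. \<Sum>a\<in>A. (cf_den (a # w) x powr (- 2 * s)) *\<^sub>R f (cf_map (a # w) x))"
  proof (rule sum.cong[OF refl])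
    fix w assume w: "w \<in> words n"
    have K: "cf_map w x \<in> K" by (rule cf_map_K[OF w assms])
    have "cf_den w x \<ge> 0" using cf_den_pos[of w x] words_not0[OF w] assms by (auto simp: K_def)
    then show "(cf_den w x powr (- 2 * s)) *\<^sub>R cf_op s f (cf_map w x)
       = (\<Sum>a\<in>A. (cf_den (a # w) x powr (- 2 * s)) *\<^sub>R f (cf_map (a # w) x))"
      using K by (auto simp: cf_op_def powr_mult scaleR_sum_right K_def intro!: sum.cong)
  qed
  finally show ?case by (simp add: sum_words_Suc)
qed simp

text \<open>The partition function: the value at 0 of the \<open>n\<close>-th iterate applied to the
  constant 1.\<close>

definition psum :: "real \<Rightarrow> nat \<Rightarrow> real" where
  "psum s n = (\<Sum>w\<in>words n. cf_den w 0 powr (- 2 * s))"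

lemma psum_pos: "psum s n > 0"
proof -
  have "words n \<noteq> {}"
    by (induction n) (use ne in \<open>auto simp: words_Suc\<close>)
  moreover have "cf_den w 0 powr (- 2 * s) > 0" if "w \<in> words n" for w
    using cf_den_pos[OF words_not0[OF that], of 0] by simp
  ultimately show ?thesis unfolding psum_def by (intro sum_pos finite_words) auto
qed

text \<open>The denominator of \<open>u @ w\<close> at 0 is that of \<open>w\<close> at 0 times that
  of \<open>u\<close> at a point of \<open>{0..1}\<close>. By bounded distortion it lies within a
  factor 2 of the product of the denominators at 0, and \<open>4 powr (- s)\<close> is this 2 raised
  to \<open>- 2 * s\<close>.\<close>

lemma psum_add:
  assumes "s \<ge> 0"
  shows "psum s (n + k) \<le> psum s n * psum s k" "4 powr (- s) * (psum s n * psum s k) \<le> psum s (n + k)"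
proof -
  have eq: "psum s (n + k) = (\<Sum>w\<in>words k. \<Sum>u\<in>words n. cf_den (u @ w) 0 powr (- 2 * s))"
    by (simp add: psum_def sum_words_add)
  have prod: "psum s n * psum s k = (\<Sum>w\<in>words k. \<Sum>u\<in>words n. (cf_den w 0 * cf_den u 0) powr (- 2 * s))"
  proof -
    have "psum s k * psum s n
        = (\<Sum>w\<in>words k. \<Sum>u\<in>words n. cf_den w 0 powr (- 2 * s) * cf_den u 0 powr (- 2 * s))"
      by (simp add: psum_def sum_product)
    also have "\<dots> = (\<Sum>w\<in>words k. \<Sum>u\<in>words n. (cf_den w 0 * cf_den u 0) powr (- 2 * s))"
      by (intro sum.cong refl powr_mult[symmetric])
    finally show ?thesis by (simp add: mult.commute)
  qed
  have bounds: "cf_den w 0 * cf_den u 0 \<le> cf_den (u @ w) 0"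
    "cf_den (u @ w) 0 \<le> 2 * (cf_den w 0 * cf_den u 0)" "cf_den w 0 * cf_den u 0 > 0"
    if "w \<in> words k" "u \<in> words n" for w u
  proof -
    have p: "cf_den w 0 > 0" "cf_den u 0 > 0" using that words_not0 cf_den_pos by auto
    have "cf_map w 0 \<in> {0..1}" using that words_not0 by (intro cf_map_unit) auto
    note c = cf_den_le[OF words_not0[OF that(2)] this]
    show "cf_den w 0 * cf_den u 0 \<le> cf_den (u @ w) 0"
      "cf_den (u @ w) 0 \<le> 2 * (cf_den w 0 * cf_den u 0)" "cf_den w 0 * cf_den u 0 > 0"
      using c p by (auto simp: cf_den_append)
  qed
  show "psum s (n + k) \<le> psum s n * psum s k"
    unfolding eq prod using bounds assms by (intro sum_mono powr_mono2') auto
  have "4 powr (- s) * (psum s n * psum s k)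
     = (\<Sum>w\<in>words k. \<Sum>u\<in>words n. (2 * (cf_den w 0 * cf_den u 0)) powr (- 2 * s))"
  proof -
    have "(2::real) powr (- 2 * s) = (2 powr 2) powr (- s)" by (subst powr_powr) simp
    then have "(2::real) powr (- 2 * s) = 4 powr (- s)" by simp
    then have "(2 * x) powr (- 2 * s) = 4 powr (- s) * x powr (- 2 * s)" for x
      by (simp only: powr_mult)
    then show ?thesis unfolding prod by (simp only: sum_distrib_left)
  qed
  also have "\<dots> \<le> psum s (n + k)"
    unfolding eq
  proof (intro sum_mono powr_mono2')
    fix w u assume "w \<in> words k" "u \<in> words n"
    note b = bounds[OF this]
    show "0 < cf_den (u @ w) 0" "cf_den (u @ w) 0 \<le> 2 * (cf_den w 0 * cf_den u 0)"
      using b by linarith+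
  qed (use assms in auto)
  finally show "4 powr (- s) * (psum s n * psum s k) \<le> psum s (n + k)" .
qed

end

text \<open>A two-sided form of Fekete's lemma. Since \<open>a\<close> is submultiplicative and
  \<open>c * a\<close> is supermultiplicative, comparison at the common index \<open>n * k\<close>
  puts every root of \<open>c * a n\<close> below every root of \<open>a k\<close>. The infimum of
  the roots of \<open>a\<close> therefore separates the two families.\<close>

lemma multiplicative_growth_rate:
  fixes a :: "nat \<Rightarrow> real"
  assumes pos: "\<And>n. a n > 0" and c: "c > 0"
    and sub: "\<And>n k. a (n + k) \<le> a n * a k"
    and sup: "\<And>n k. c * (a n * a k) \<le> a (n + k)"
  obtains r where "r > 0" "\<And>n. n \<ge> 1 \<Longrightarrow> r ^ n \<le> a n" "\<And>n. n \<ge> 1 \<Longrightarrow> c * a n \<le> r ^ n"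
proof -
  have 1: "a (n * Suc k) \<le> a n ^ Suc k" for n k
  proof (induction k)
    case (Suc k)
    have "a (n * Suc (Suc k)) \<le> a n * a (n * Suc k)" using sub[of n "n * Suc k"] by simp
    also have "\<dots> \<le> a n * a n ^ Suc k" using Suc pos[of n] by (intro mult_left_mono) auto
    finally show ?case by simp
  qed simp
  have 2: "(c * a n) ^ Suc k \<le> c * a (n * Suc k)" for n k
  proof (induction k)
    case (Suc k)
    have "(c * a n) ^ Suc (Suc k) \<le> (c * a n) * (c * a (n * Suc k))"
      using Suc pos[of n] c by (simp add: mult_left_mono)
    also have "\<dots> = c * (c * (a n * a (n * Suc k)))" by simp
    also have "\<dots> \<le> c * a (n + n * Suc k)" using sup[of n "n * Suc k"] c by (intro mult_left_mono) auto
    finally show ?case by simp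
  qed simp
  have c1: "c \<le> 1"
  proof -
    have "c * (a 1 * a 1) \<le> a 1 * a 1" using sup[of 1 1] sub[of 1 1] by linarith
    then show ?thesis using pos[of 1] by simp
  qed
  have key: "root n (c * a n) \<le> root k (a k)" if nk: "n \<ge> 1" "k \<ge> 1" for n k
  proof -
    obtain k' n' where k': "k = Suc k'" "n = Suc n'" using nk by (metis Suc_pred' less_eq_Suc_le One_nat_def)
    have "(c * a n) ^ k \<le> c * a (n * k)" using 2[of n k'] k' by simp
    also have "\<dots> \<le> a (n * k)" using c1 pos[of "n * k"] by simp
    also have "\<dots> = a (k * n)" by (simp add: mult.commute)
    also have "\<dots> \<le> a k ^ n" using 1[of k n'] k' by simp
    finally have "root (n * k) ((c * a n) ^ k) \<le> root (n * k) (a k ^ n)"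
      using nk by (intro real_root_le_mono) auto
    moreover have "root (n * k) ((c * a n) ^ k) = root n (c * a n)"
      using nk c pos[of n] by (subst real_root_mult_exp) (simp add: real_root_power_cancel less_imp_le)
    moreover have "root (n * k) (a k ^ n) = root k (a k)"
      using nk c pos[of k] by (subst mult.commute, subst real_root_mult_exp) (simp add: real_root_power_cancel less_imp_le)
    ultimately show ?thesis by simp
  qed
  define r where "r = (INF k\<in>{1..}. root k (a k))"
  have bdd: "bdd_below ((\<lambda>k. root k (a k)) ` {1..})"
    using key[of 1] by (intro bdd_belowI[of _ "root 1 (c * a 1)"]) auto
  have le: "r \<le> root n (a n)" if "n \<ge> 1" for n
    unfolding r_def using that bdd by (intro cINF_lower) auto
  have ge: "root n (c * a n) \<le> r" if "n \<ge> 1" for n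
    unfolding r_def using that key by (intro cINF_greatest) auto
  have "r > 0" using ge[of 1] pos[of 1] c by (simp add: less_le_trans[of 0 "c * a 1" r])
  moreover have "r ^ n \<le> a n" if "n \<ge> 1" for n
  proof -
    have "r ^ n \<le> root n (a n) ^ n" using le[OF that] \<open>r > 0\<close> by (intro power_mono) auto
    then show ?thesis using that pos[of n] by (simp add: less_imp_le)
  qed
  moreover have "c * a n \<le> r ^ n" if "n \<ge> 1" for n
  proof -
    have "root n (c * a n) ^ n \<le> r ^ n" using ge[OF that] that c pos[of n]
      by (intro power_mono) (auto simp: less_imp_le)
    then show ?thesis using that pos[of n] c by (simp add: less_imp_le)
  qed
  ultimately show ?thesis using that by blast
qed

section \<open>The eigenfunction as an integral of kernels\<close>

lemma kernel_bound:
  fixes c :: real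
  assumes "0 \<le> c" "c \<le> 1" "0 \<le> x" "0 \<le> b"
  shows "0 \<le> c ^ k * (1 + x * c) powr (- b)" "c ^ k * (1 + x * c) powr (- b) \<le> 1"
proof -
  have "1 + x * c \<ge> 1" using assms by simp
  then have "(1 + x * c) powr (- b) \<le> 1 powr (- b)"
    using assms by (intro powr_mono2') auto
  then have "(1 + x * c) powr (- b) \<le> 1" by (simp only: powr_one_eq_one)
  moreover have "c ^ k \<le> 1" using assms by (simp add: power_le_one)
  ultimately show "c ^ k * (1 + x * c) powr (- b) \<le> 1"
    using assms mult_mono[of "c ^ k" 1 "(1 + x * c) powr (- b)" 1] by simp
  show "0 \<le> c ^ k * (1 + x * c) powr (- b)" using assms by simp
qed

lemma (in prob_space) kernel_integrable:
  fixes g :: "'a \<Rightarrow> real"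
  assumes [measurable]: "g \<in> borel_measurable M"
    and "\<And>y. 0 \<le> g y" "\<And>y. g y \<le> 1" "0 \<le> x" "0 \<le> b"
  shows "integrable M (\<lambda>y. g y ^ k * (1 + x * g y) powr (- b))"
proof (rule integrable_const_bound[where B = 1])
  show "AE y in M. norm (g y ^ k * (1 + x * g y) powr (- b)) \<le> 1"
  proof (rule AE_I2)
    fix y
    show "norm (g y ^ k * (1 + x * g y) powr (- b)) \<le> 1"
      using kernel_bound[of "g y" x b k] assms(2-5) by (simp only: real_norm_def abs_of_nonneg)
  qed
qed measurable

lemma kernel_deriv:
  fixes c :: real
  assumes "0 \<le> c" "0 \<le> x"
  shows "((\<lambda>x. c ^ k * (1 + x * c) powr (- b)) has_real_derivative
      - b * (c ^ Suc k * (1 + x * c) powr (- (b + 1)))) (at x within S)"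
proof -
  have "1 + x * c > 0" using assms by (simp add: add_pos_nonneg)
  then have "((\<lambda>x. (1 + x * c) powr (- b)) has_real_derivative
      - b * (1 + x * c) powr (- b - 1) * c) (at x within S)"
    by (auto intro!: derivative_eq_intros)
  from DERIV_cmult[OF this, of "c ^ k"] show ?thesis by (simp add: mult_ac)
qed

text \<open>Dominated convergence applies because the \<open>x\<close>-derivative of the kernel is
  bounded by \<open>b\<close>, and hence so are the difference quotients. Working within
  \<open>{0..}\<close> includes the one-sided derivative at 0.\<close>

lemma (in prob_space) kernel_integral_deriv:
  fixes g :: "'a \<Rightarrow> real"
  assumes [measurable]: "g \<in> borel_measurable M"
    and g: "\<And>y. 0 \<le> g y" "\<And>y. g y \<le> 1" and b: "0 \<le> b" and x: "0 \<le> x"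
  shows "((\<lambda>x. \<integral>y. g y ^ k * (1 + x * g y) powr (- b) \<partial>M) has_real_derivative
      - b * (\<integral>y. g y ^ Suc k * (1 + x * g y) powr (- (b + 1)) \<partial>M)) (at x within {0..})"
  unfolding has_field_derivative_iff tendsto_at_iff_sequentially
proof (intro allI impI)
  fix X :: "nat \<Rightarrow> real"
  assume X: "\<forall>i. X i \<in> {0..} - {x}" and lim: "X \<longlonglongrightarrow> x"
  define h where "h = (\<lambda>x y. g y ^ k * (1 + x * g y) powr (- b))"
  define h' where "h' = (\<lambda>x y. - b * (g y ^ Suc k * (1 + x * g y) powr (- (b + 1))))"
  have int: "integrable M (h t)" if "t \<ge> 0" for t
    unfolding h_def using that b g by (intro kernel_integrable) auto
  have D: "((\<lambda>t. h t y) has_real_derivative h' t y) (at t within {0..})" if "t \<ge> 0" for t y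
    unfolding h_def h'_def by (rule kernel_deriv[OF g(1) that])
  have bnd: "norm (h' t y) \<le> b" if "t \<ge> 0" for t y
  proof -
    note kb = kernel_bound[OF g(1)[of y] g(2)[of y] that, of "b + 1" "Suc k"]
    have "norm (h' t y) = b * (g y ^ Suc k * (1 + t * g y) powr (- (b + 1)))"
      using abs_of_nonneg[OF kb(1)] b by (simp only: h'_def norm_mult real_norm_def abs_minus_cancel) simp
    also have "\<dots> \<le> b * 1" using kb b by (intro mult_left_mono) auto
    finally show ?thesis by simp
  qed
  have meas [measurable]: "h t \<in> borel_measurable M" "h' t \<in> borel_measurable M" for t
    unfolding h_def h'_def by measurable
  have "(\<lambda>i. \<integral>y. (h (X i) y - h x y) / (X i - x) \<partial>M) \<longlonglongrightarrow> (\<integral>y. h' x y \<partial>M)"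
  proof (rule integral_dominated_convergence[where w = "\<lambda>_. b"])
    show "AE y in M. (\<lambda>i. (h (X i) y - h x y) / (X i - x)) \<longlonglongrightarrow> h' x y"
      using D[OF x] X lim
      unfolding has_field_derivative_iff tendsto_at_iff_sequentially comp_def by (intro AE_I2) blast
    show "AE y in M. norm ((h (X i) y - h x y) / (X i - x)) \<le> b" for i
    proof (intro AE_I2)
      fix y
      have "norm (h (X i) y - h x y) \<le> b * norm (X i - x)"
        using X x bnd D by (intro field_differentiable_bound[of "{0..}" "\<lambda>t. h t y" "\<lambda>t. h' t y"]) auto
      moreover have "norm (X i - x) > 0" using X by auto
      ultimately show "norm ((h (X i) y - h x y) / (X i - x)) \<le> b"
        by (simp add: norm_divide divide_le_eq)
    qed
  qed auto
  moreover have "(\<integral>y. (h (X i) y - h x y) / (X i - x) \<partial>M) = (integral\<^sup>L M (h (X i)) - integral\<^sup>L M (h x)) / (X i - x)" for i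
    using int[of "X i"] int[OF x] X by auto
  moreover have "(\<integral>y. h' x y \<partial>M) = - b * (\<integral>y. g y ^ Suc k * (1 + x * g y) powr (- (b + 1)) \<partial>M)"
    unfolding h'_def by (rule integral_mult_right_zero)
  ultimately show "((\<lambda>y. ((\<integral>ya. g ya ^ k * (1 + y * g ya) powr - b \<partial>M) - (\<integral>y. g y ^ k * (1 + x * g y) powr - b \<partial>M)) / (y - x)) \<circ> X)
      \<longlonglongrightarrow> - b * (\<integral>y. g y ^ Suc k * (1 + x * g y) powr (- (b + 1)) \<partial>M)"
    unfolding comp_def h_def by (simp only:)
qed

context digits
begin

text \<open>\<open>lo\<close> and \<open>hi\<close> enclose the ratios \<open>C / D\<close>. The
  value of \<open>lo\<close> is \<open>1 / (x + a)\<close> at the largest point of \<open>K\<close>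
  and the largest digit; adding a further \<open>x \<le> 1 / Min A\<close> to \<open>1 / lo\<close>
  produces the constant \<open>2 / Min A + Max A\<close> of the derivative bound.\<close>

definition lo :: real where "lo = 1 / (1 / real (Min A) + real (Max A))"

definition hi :: real where "hi = 1 / real (Min A)"

lemma lo_hi: "0 < lo" "lo \<le> hi" "hi \<le> 1"
proof -
  have "Min A \<le> Max A" using fin ne by simp
  moreover have "real (Min A) \<ge> 1" using Min_ge_1 by simp
  moreover have "real (Min A) \<le> 1 / real (Min A) + real (Max A)"
    using calculation by (simp add: add_increasing)
  ultimately show "0 < lo" "lo \<le> hi" "hi \<le> 1"
    by (auto simp: lo_def hi_def intro!: divide_left_mono add_nonneg_pos mult_pos_pos)
qed

text \<open>The empty word has ratio 0, which lies below \<open>lo\<close>; for this reason the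
  averages that define the measures start at index 1.\<close>

lemma cf_map_rev_bounds:
  assumes "w \<in> words n" "n \<ge> 1"
  shows "lo \<le> cf_map (rev w) 0" "cf_map (rev w) 0 \<le> hi"
proof -
  obtain k where "n = Suc k" using assms(2) by (cases n) auto
  then have "rev w \<in> words (Suc k)" using assms by (auto simp: words_def)
  then obtain a u where u: "rev w = a # u" "a \<in> A" "u \<in> words k" by (auto simp: words_Suc)
  have "cf_map u 0 \<in> K" by (rule cf_map_K[OF u(3) zero_in_K])
  moreover have "real a \<le> real (Max A)" using u fin by simp
  ultimately show "lo \<le> cf_map (rev w) 0"
    using digit_ge_1[OF u(2)] unfolding u(1) by (auto simp: lo_def K_def theta_def intro!: divide_left_mono mult_pos_pos)
  show "cf_map (rev w) 0 \<le> hi"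
    using theta_K[OF u(2), of "cf_map u 0"] \<open>cf_map u 0 \<in> K\<close> u(1) by (simp add: K_def hi_def)
qed

definition opsum :: "real \<Rightarrow> nat \<Rightarrow> real \<Rightarrow> real" where
  "opsum s n x = (\<Sum>w\<in>words n. cf_den w x powr (- 2 * s))"

lemma opsum_eq: "opsum s n x = (\<Sum>w\<in>words n. cf_den w 0 powr (- 2 * s) * (1 + x * cf_map (rev w) 0) powr (- 2 * s))"
  if "x \<in> K"
  unfolding opsum_def
proof (rule sum.cong[OF refl])
  fix w assume w: "w \<in> words n"
  have "x \<ge> 0" using that by (simp add: K_def)
  show "cf_den w x powr (- 2 * s) = cf_den w 0 powr (- 2 * s) * (1 + x * cf_map (rev w) 0) powr (- 2 * s)"
    by (subst cf_den_eq[OF words_not0[OF w] \<open>x \<ge> 0\<close>]) (rule powr_mult)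
qed

lemma opsum_Suc: "(\<Sum>a\<in>A. (x + real a) powr (- 2 * s) * opsum s n (theta a x)) = opsum s (Suc n) x"
  if "x \<in> K"
proof -
  have *: "opsum s n y = (cf_op s ^^ n) (\<lambda>_. 1::real) y" if "y \<in> K" for n y
    by (simp add: cf_op_funpow[OF that] opsum_def)
  have "opsum s (Suc n) x = cf_op s ((cf_op s ^^ n) (\<lambda>_. 1::real)) x" by (simp add: *[OF that])
  also have "\<dots> = (\<Sum>a\<in>A. (x + real a) powr (- 2 * s) * opsum s n (theta a x))"
    using that theta_K by (auto simp: cf_op_def * K_def intro!: sum.cong)
  finally show ?thesis by simp
qed

lemma opsum_bounds:
  assumes "x \<in> K" "s \<ge> 0"
  shows "0 \<le> opsum s n x" "opsum s n x \<le> psum s n"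
proof -
  show "0 \<le> opsum s n x" by (simp add: opsum_def sum_nonneg)
  show "opsum s n x \<le> psum s n"
    unfolding opsum_def psum_def
    using assms K_unit by (intro sum_mono powr_mono2')
      (auto intro!: cf_den_pos cf_den_le dest: words_not0)
qed

text \<open>
  The measure is a weak limit of normalised sums of point masses at \<open>C / D\<close>. Clamping the integration
  variable to the interval that carries these masses makes it unnecessary to locate the support of
  the limit.
\<close>

lemma eigenmeasure_exists:
  assumes s: "s \<ge> 0"
  obtains r M where "r > 0" "\<And>n. n \<ge> 1 \<Longrightarrow> r ^ n \<le> psum s n" "\<And>n. n \<ge> 1 \<Longrightarrow> 4 powr (- s) * psum s n \<le> r ^ n"
    "real_distribution M"
    "\<And>x. x \<in> K \<Longrightarrow>
      (\<Sum>a\<in>A. (x + real a) powr (- 2 * s) * (\<integral>y. (1 + theta a x * max lo (min hi y)) powr (- 2 * s) \<partial>M))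
        = r * (\<integral>y. (1 + x * max lo (min hi y)) powr (- 2 * s) \<partial>M)"
proof -
  obtain r where r: "r > 0" "\<And>n. n \<ge> 1 \<Longrightarrow> r ^ n \<le> psum s n"
      "\<And>n. n \<ge> 1 \<Longrightarrow> 4 powr (- s) * psum s n \<le> r ^ n"
    using multiplicative_growth_rate[of "psum s" "4 powr (- s)"] psum_pos psum_add[OF s] by auto
  \<comment> \<open>\<open>S n\<close> is the total mass before normalisation. Each summand is at
    least 1 because \<open>r ^ k \<le> psum s k\<close>, so \<open>S n\<close> grows at least
    linearly, and this is what makes the error in the eigenvalue equation vanish.\<close>
  define S where "S = (\<lambda>n. \<Sum>k=1..Suc n. psum s k / r ^ k)"
  have S: "S n \<ge> Suc n" for n
  proof -
    have "(\<Sum>k=1..Suc n. 1) \<le> S n"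
      unfolding S_def using r by (intro sum_mono) (simp add: le_divide_eq)
    then show ?thesis by simp
  qed
  have Spos: "S n > 0" for n using S[of n] by linarith
  \<comment> \<open>The masses are indexed by words and only then pushed forward to
    \<open>C / D\<close>, since distinct words such as \<open>[1, 1]\<close> and \<open>[2]\<close>
    can have the same ratio.\<close>
  define W where "W = (\<lambda>n. SIGMA k:{1..Suc n}. words k)"
  have finW: "finite (W n)" for n unfolding W_def by (auto simp: finite_words)
  define f where "f = (\<lambda>n (k::nat, w). cf_den w 0 powr (- 2 * s) / r ^ k / S n)"
  have f_nonneg: "f n p \<ge> 0" for n p
    unfolding f_def using Spos[of n] r(1) by (auto simp: case_prod_unfold)
  have sumf: "(\<Sum>p\<in>W n. f n p * h (snd p)) =
      (\<Sum>k=1..Suc n. (\<Sum>w\<in>words k. cf_den w 0 powr (- 2 * s) * h w) / r ^ k) / S n" for n and h :: "nat list \<Rightarrow> real"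
  proof -
    have "(\<Sum>p\<in>W n. f n p * h (snd p)) = (\<Sum>(k, w)\<in>W n. cf_den w 0 powr (- 2 * s) / r ^ k / S n * h w)"
      by (simp add: f_def case_prod_unfold)
    also have "\<dots> = (\<Sum>k=1..Suc n. \<Sum>w\<in>words k. cf_den w 0 powr (- 2 * s) / r ^ k / S n * h w)"
      unfolding W_def by (rule sum.Sigma[symmetric]) (auto simp: finite_words)
    also have "\<dots> = (\<Sum>k=1..Suc n. (\<Sum>w\<in>words k. cf_den w 0 powr (- 2 * s) * h w) / r ^ k) / S n"
      unfolding sum_divide_distrib by (intro sum.cong refl) simp
    finally show ?thesis .
  qed
  have sum1: "(\<Sum>p\<in>W n. f n p) = 1" for n
  proof -
    have "(\<Sum>p\<in>W n. f n p) = S n / S n"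
      using sumf[of n "\<lambda>_. 1"] by (simp only: mult_1_right psum_def S_def)
    then show ?thesis using Spos[of n] by simp
  qed
  define P where "P = (\<lambda>n. point_measure (W n) (\<lambda>p. ennreal (f n p)))"
  have prob: "prob_space (P n)" for n
  proof
    show "emeasure (P n) (space (P n)) = 1"
      unfolding P_def using finW[of n] f_nonneg
      by (simp add: emeasure_point_measure_finite space_point_measure sum_ennreal sum1)
  qed
  define mu where "mu = (\<lambda>n. distr (P n) borel (\<lambda>p. cf_map (rev (snd p)) 0))"
  have meas: "(\<lambda>p. cf_map (rev (snd p)) 0) \<in> borel_measurable (P n)" for n
    unfolding P_def by simp
  have rd: "real_distribution (mu n)" for n
    unfolding mu_def using prob_space.real_distribution_distr[OF prob meas] .
  have int_mu: "(\<integral>y. h y \<partial>mu n) =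
      (\<Sum>k=1..Suc n. (\<Sum>w\<in>words k. cf_den w 0 powr (- 2 * s) * h (cf_map (rev w) 0)) / r ^ k) / S n"
    if "h \<in> borel_measurable borel" for n and h :: "real \<Rightarrow> real"
  proof -
    have "(\<integral>y. h y \<partial>mu n) = (\<integral>p. h (cf_map (rev (snd p)) 0) \<partial>P n)"
      unfolding mu_def by (rule integral_distr[OF meas that])
    also have "\<dots> = (\<Sum>p\<in>W n. f n p * h (cf_map (rev (snd p)) 0))"
      unfolding P_def using finW f_nonneg by (subst lebesgue_integral_point_measure_finite) auto
    finally show ?thesis by (simp add: sumf[of n "\<lambda>w. h (cf_map (rev w) 0)"])
  qed
  define g where "g = (\<lambda>y. max lo (min hi y))"
  have g: "0 \<le> g y" "g y \<le> 1" for y using lo_hi by (auto simp: g_def)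
  have gcont: "isCont g y" for y unfolding g_def by (intro continuous_intros)
  define h where "h = (\<lambda>x y. (1 + x * g y) powr (- 2 * s))"
  have hcont: "isCont (h x) y" if "x \<ge> 0" for x y
  proof -
    have "1 + x * g y > 0" using that g(1)[of y] by (simp add: add_pos_nonneg)
    then show ?thesis unfolding h_def using gcont by (intro continuous_intros) auto
  qed
  have hbd: "norm (h x y) \<le> 1" if "x \<ge> 0" for x y
    using kernel_bound[OF g(1)[of y] g(2)[of y] that, where b = "2 * s" and k = 0] s by (simp add: h_def)
  define V where "V = (\<lambda>n x. \<integral>y. h x y \<partial>mu n)"
  have V: "V n x = (\<Sum>k=1..Suc n. opsum s k x / r ^ k) / S n" if "x \<in> K" for n x
  proof -
    have x: "x \<ge> 0" using that by (simp add: K_def)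
    have "h x \<in> borel_measurable borel"
      using hcont[OF x] by (intro borel_measurable_continuous_onI continuous_at_imp_continuous_on) auto
    from int_mu[OF this] have "V n x = (\<Sum>k=1..Suc n. (\<Sum>w\<in>words k. cf_den w 0 powr (- 2 * s) * h x (cf_map (rev w) 0)) / r ^ k) / S n"
      unfolding V_def .
    also have "\<dots> = (\<Sum>k=1..Suc n. opsum s k x / r ^ k) / S n"
      using cf_map_rev_bounds unfolding opsum_eq[OF that]
      by (intro arg_cong[where f = "\<lambda>t. t / S n"] sum.cong refl arg_cong2[where f = "(/)"])
        (auto simp: h_def g_def)
    finally show ?thesis .
  qed
  have tight: "tight mu"
    unfolding tight_def
  proof (intro conjI allI impI)
    show "real_distribution (mu n)" for n by (rule rd)
    fix e :: real assume "e > 0"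
    \<comment> \<open>Every mass sits in \<open>{lo..hi}\<close>, so a single interval has full
      measure for all \<open>n\<close>.\<close>
    have "measure (mu n) {0<..2} > 1 - e" for n
    proof -
      interpret mu: real_distribution "mu n" by (rule rd)
      have "measure (mu n) {0<..2} = (\<integral>y. indicator {0<..2} y \<partial>mu n)" by simp
      also have "\<dots> = (\<Sum>k=1..Suc n. (\<Sum>w\<in>words k. cf_den w 0 powr (- 2 * s) * indicator {0<..2} (cf_map (rev w) 0)) / r ^ k) / S n"
        by (rule int_mu) auto
      also have "\<dots> = (\<Sum>k=1..Suc n. psum s k / r ^ k) / S n"
      proof -
        have "cf_map (rev w) 0 \<in> {0<..2}" if "w \<in> words k" "k \<ge> 1" for w k
          using cf_map_rev_bounds[OF that] lo_hi by auto
        then show ?thesis unfolding psum_def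
          by (intro arg_cong[where f = "\<lambda>t. t / S n"] sum.cong refl arg_cong2[where f = "(/)"]) auto
      qed
      also have "\<dots> = 1" using Spos[of n] by (simp add: S_def)
      finally show ?thesis using \<open>e > 0\<close> by simp
    qed
    then show "\<exists>a b. a < b \<and> (\<forall>n. measure (mu n) {a<..b} > 1 - e)" by (intro exI[of _ 0] exI[of _ 2]) auto
  qed
  obtain q M where q: "strict_mono (q :: nat \<Rightarrow> nat)" and M: "real_distribution M"
      and wc: "weak_conv_m (mu \<circ> id \<circ> q) M"
    using tight_imp_convergent_subsubsequence[OF tight strict_mono_id] by blast
  have conv: "(\<lambda>n. V (q n) x) \<longlonglongrightarrow> (\<integral>y. h x y \<partial>M)" if "x \<ge> 0" for x
  proof -
    have "(\<lambda>n. integral\<^sup>L ((mu \<circ> id \<circ> q) n) (h x)) \<longlonglongrightarrow> integral\<^sup>L M (h x)"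
    proof (rule weak_conv_imp_integral_bdd_continuous_conv[OF _ M wc])
      show "real_distribution ((mu \<circ> id \<circ> q) n)" for n using rd by simp
    qed (use hcont hbd that in auto)
    then show ?thesis by (simp add: V_def comp_def)
  qed
  have eig: "(\<Sum>a\<in>A. (x + real a) powr (- 2 * s) * (\<integral>y. h (theta a x) y \<partial>M)) = r * (\<integral>y. h x y \<partial>M)"
    if x: "x \<in> K" for x
  proof -
    have x0: "x \<ge> 0" using x by (simp add: K_def)
    \<comment> \<open>The defect of the averages in the eigenvalue equation. The operator turns
      \<open>opsum s k\<close> into \<open>opsum s (Suc k)\<close>, so after division by powers of
      \<open>r\<close> the sum telescopes to two bounded end terms, and division by
      \<open>S n\<close> sends it to 0.\<close>
    define d where "d = (\<lambda>n. (\<Sum>a\<in>A. (x + real a) powr (- 2 * s) * V n (theta a x)) - r * V n x)"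
    have d: "d n = r / S n * (opsum s (Suc (Suc n)) x / r ^ Suc (Suc n) - opsum s 1 x / r ^ 1)" for n
    proof -
      have "(\<Sum>a\<in>A. (x + real a) powr (- 2 * s) * V n (theta a x))
         = (\<Sum>a\<in>A. \<Sum>k=1..Suc n. (x + real a) powr (- 2 * s) * opsum s k (theta a x) / r ^ k / S n)"
        using theta_K x0 by (intro sum.cong refl)
          (simp only: V sum_divide_distrib sum_distrib_left times_divide_eq_right)
      also have "\<dots> = (\<Sum>k=1..Suc n. \<Sum>a\<in>A. (x + real a) powr (- 2 * s) * opsum s k (theta a x) / r ^ k / S n)"
        by (rule sum.swap)
      also have "\<dots> = (\<Sum>k=1..Suc n. opsum s (Suc k) x / r ^ k / S n)"
        by (simp only: sum_divide_distrib[symmetric] opsum_Suc[OF x])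
      also have "\<dots> - r * V n x = (\<Sum>k=1..Suc n. r / S n * (opsum s (Suc k) x / r ^ Suc k - opsum s k x / r ^ k))"
        unfolding V[OF x] sum_divide_distrib sum_distrib_left sum_subtractf[symmetric]
        using r(1) Spos[of n] by (intro sum.cong refl) (simp add: field_simps)
      also have "\<dots> = r / S n * (\<Sum>k=1..Suc n. opsum s (Suc k) x / r ^ Suc k - opsum s k x / r ^ k)"
        by (simp only: sum_distrib_left)
      also have "(\<Sum>k=1..Suc n. opsum s (Suc k) x / r ^ Suc k - opsum s k x / r ^ k)
          = opsum s (Suc (Suc n)) x / r ^ Suc (Suc n) - opsum s 1 x / r ^ 1"
        by (subst sum_Suc_diff) auto
      finally show ?thesis by (simp add: d_def)
    qed
    have tm: "0 \<le> opsum s k x / r ^ k \<and> opsum s k x / r ^ k \<le> 4 powr s" if "k \<ge> 1" for k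
    proof -
      have "psum s k \<le> 4 powr s * r ^ k" using r(3)[OF that] by (simp add: powr_minus field_simps)
      then have "opsum s k x \<le> 4 powr s * r ^ k" using opsum_bounds[OF x s, of k] by linarith
      then show ?thesis using r(1) opsum_bounds[OF x s, of k] by (simp add: divide_le_eq)
    qed
    have dle: "norm (d n) \<le> r * 4 powr s / real (Suc n)" for n
    proof -
      have "norm (d n) = r / S n * \<bar>opsum s (Suc (Suc n)) x / r ^ Suc (Suc n) - opsum s 1 x / r ^ 1\<bar>"
        unfolding d using r(1) Spos[of n] by (simp only: real_norm_def abs_mult) simp
      also have "\<dots> \<le> r / S n * 4 powr s"
        using tm[of "Suc (Suc n)"] tm[of 1] r(1) Spos[of n] by (intro mult_left_mono) (auto simp: abs_le_iff)
      also have "\<dots> \<le> r / real (Suc n) * 4 powr s"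
        using S[of n] r(1) Spos[of n] by (intro mult_right_mono divide_left_mono mult_pos_pos) auto
      finally show ?thesis by simp
    qed
    have "(\<lambda>n. r * 4 powr s / real (Suc n)) \<longlonglongrightarrow> 0"
      using lim_const_over_n[of "r * 4 powr s"] LIMSEQ_Suc by blast
    then have "d \<longlonglongrightarrow> 0" by (rule Lim_null_comparison[rotated]) (intro always_eventually allI dle)
    then have "(\<lambda>n. d (q n)) \<longlonglongrightarrow> 0" using LIMSEQ_subseq_LIMSEQ[OF _ q, of d] by (simp add: comp_def)
    moreover have "(\<lambda>n. d (q n)) \<longlonglongrightarrow>
        (\<Sum>a\<in>A. (x + real a) powr (- 2 * s) * (\<integral>y. h (theta a x) y \<partial>M)) - r * (\<integral>y. h x y \<partial>M)"
      unfolding d_def using x0 by (intro tendsto_intros conv) (auto simp: theta_def)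
    ultimately have "0 = (\<Sum>a\<in>A. (x + real a) powr (- 2 * s) * (\<integral>y. h (theta a x) y \<partial>M)) - r * (\<integral>y. h x y \<partial>M)"
      by (rule LIMSEQ_unique)
    then show ?thesis by simp
  qed
  show ?thesis
    by (rule that[OF r M]) (use eig in \<open>simp_all only: h_def g_def\<close>)
qed

text \<open>The whole family \<open>F\<close> of derivatives is carried along, each member being an
  explicit integral. The bounds for every order then follow from pointwise comparison of
  integrands.\<close>

lemma eigenfunction_exists:
  assumes s: "s \<ge> 0"
  obtains r F where "r > 0" "\<And>n. n \<ge> 1 \<Longrightarrow> r ^ n \<le> psum s n" "\<And>n. n \<ge> 1 \<Longrightarrow> 4 powr (- s) * psum s n \<le> r ^ n"
    "\<And>x. x \<in> K \<Longrightarrow> F 0 x > 0"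
    "\<And>x. x \<in> K \<Longrightarrow> (\<Sum>a\<in>A. (x + real a) powr (- 2 * s) * F 0 (theta a x)) = r * F 0 x"
    "\<And>p x. x \<in> K \<Longrightarrow> (F p has_real_derivative F (Suc p) x) (at x within K)"
    "\<And>p x. x \<in> K \<Longrightarrow>
      (\<Prod>i<p. 2 * s + real i) / (2 / real (Min A) + real (Max A)) ^ p * F 0 x \<le> (- 1) ^ p * F p x"
    "\<And>p x. x \<in> K \<Longrightarrow> (- 1) ^ p * F p x \<le> (\<Prod>i<p. 2 * s + real i) / real (Min A) ^ p * F 0 x"
proof -
  obtain r M where r: "r > 0" "\<And>n. n \<ge> 1 \<Longrightarrow> r ^ n \<le> psum s n"
      "\<And>n. n \<ge> 1 \<Longrightarrow> 4 powr (- s) * psum s n \<le> r ^ n"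
    and M: "real_distribution M"
    and eig: "\<And>x. x \<in> K \<Longrightarrow>
      (\<Sum>a\<in>A. (x + real a) powr (- 2 * s) * (\<integral>y. (1 + theta a x * max lo (min hi y)) powr (- 2 * s) \<partial>M))
        = r * (\<integral>y. (1 + x * max lo (min hi y)) powr (- 2 * s) \<partial>M)"
    by (rule eigenmeasure_exists[OF s]) (rule that)
  interpret M: real_distribution M by (rule M)
  define g :: "real \<Rightarrow> real" where "g = (\<lambda>y. max lo (min hi y))"
  have g: "0 \<le> g y" "g y \<le> 1" "lo \<le> g y" "g y \<le> hi" for y using lo_hi by (auto simp: g_def)
  have [measurable]: "g \<in> borel_measurable M" unfolding g_def by measurable
  define J where "J = (\<lambda>p x. \<integral>y. g y ^ p * (1 + x * g y) powr (- (2 * s + real p)) \<partial>M)"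
  define c where "c = (\<lambda>p. \<Prod>i<p. 2 * s + real i)"
  have c: "c p \<ge> 0" for p unfolding c_def using s by (intro prod_nonneg) auto
  define F where "F = (\<lambda>p x. (- 1) ^ p * c p * J p x)"
  have F0: "F 0 x = (\<integral>y. (1 + x * g y) powr (- 2 * s) \<partial>M)" for x
    by (simp add: F_def c_def J_def)
  have int: "integrable M (\<lambda>y. g y ^ p * (1 + x * g y) powr (- (2 * s + real p)))" if "x \<ge> 0" for p x
    using s that g by (intro M.kernel_integrable) auto
  have Kx: "x \<ge> 0" "x \<le> 1" "x \<le> 1 / real (Min A)" if "x \<in> K" for x
    using that K_unit by (auto simp: K_def)
  have split: "g y ^ p * (1 + x * g y) powr (- (2 * s + real p)) =
      (g y / (1 + x * g y)) ^ p * (1 + x * g y) powr (- (2 * s))" if "x \<ge> 0" for x y p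
  proof -
    have pos: "1 + x * g y > 0" using that g(1)[of y] by (simp add: add_pos_nonneg)
    have "(1 + x * g y) powr (- (2 * s + real p)) = (1 + x * g y) powr (- (2 * s)) / (1 + x * g y) ^ p"
      using pos by (simp add: powr_diff powr_realpow)
    then show ?thesis by (simp add: power_divide)
  qed
  have J0: "J 0 x = F 0 x" for x by (simp add: F_def c_def)
  have F0_pos: "F 0 x > 0" if "x \<in> K" for x
  proof -
    have "2 powr (- (2 * s)) \<le> (1 + x * g y) powr (- (2 * s))" for y
      using Kx[OF that] g(1,2)[of y] s mult_mono[of x 1 "g y" 1]
      by (intro powr_mono2') (auto simp: add_pos_nonneg)
    then have "2 powr (- (2 * s)) \<le> J 0 x"
      unfolding J_def using int[of x 0] Kx[OF that] by (intro M.integral_ge_const) auto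
    then show ?thesis unfolding J0[symmetric] by (rule less_le_trans[rotated]) simp
  qed
  \<comment> \<open>The quotient equals \<open>1 / (1 / g y + x)\<close>, and \<open>1 / g y\<close>
    lies between \<open>Min A\<close> and \<open>1 / Min A + Max A\<close> by the clamping.\<close>
  have ratio: "1 / (2 / real (Min A) + real (Max A)) \<le> g y / (1 + x * g y)"
    "g y / (1 + x * g y) \<le> 1 / real (Min A)" "0 \<le> g y / (1 + x * g y)" if "x \<in> K" for x y
  proof -
    have gp: "g y > 0" using g(3)[of y] lo_hi by linarith
    then have eq: "g y / (1 + x * g y) = 1 / (1 / g y + x)"
      using Kx[OF that] by (simp add: field_simps)
    have mp: "real (Min A) > 0" using Min_ge_1 by simp
    have "1 / g y \<le> 1 / lo" using g(3) lo_hi gp by (intro divide_left_mono mult_pos_pos) auto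
    also have "1 / lo = 1 / real (Min A) + real (Max A)" by (simp add: lo_def)
    finally have "1 / g y + x \<le> 2 / real (Min A) + real (Max A)" using Kx[OF that] by simp
    then show "1 / (2 / real (Min A) + real (Max A)) \<le> g y / (1 + x * g y)"
      unfolding eq using gp Kx[OF that] mp by (intro divide_left_mono mult_pos_pos) (auto simp: add_pos_nonneg)
    have "g y / (1 + x * g y) \<le> g y / 1"
      using gp Kx[OF that] by (intro divide_left_mono) (auto simp: add_pos_nonneg)
    then show "g y / (1 + x * g y) \<le> 1 / real (Min A)" using g(4)[of y] by (simp add: hi_def)
    show "0 \<le> g y / (1 + x * g y)" using gp Kx[OF that] by simp
  qed
  have Jlow: "(1 / (2 / real (Min A) + real (Max A))) ^ p * J 0 x \<le> J p x" if "x \<in> K" for p x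
  proof -
    have "(1 / (2 / real (Min A) + real (Max A))) ^ p * J 0 x =
        (\<integral>y. (1 / (2 / real (Min A) + real (Max A))) ^ p * (g y ^ 0 * (1 + x * g y) powr (- (2 * s + real 0))) \<partial>M)"
      unfolding J_def by simp
    also have "\<dots> \<le> J p x"
      unfolding J_def
    proof (rule integral_mono)
      fix y
      show "(1 / (2 / real (Min A) + real (Max A))) ^ p * (g y ^ 0 * (1 + x * g y) powr (- (2 * s + real 0)))
          \<le> g y ^ p * (1 + x * g y) powr (- (2 * s + real p))"
        unfolding split[OF Kx(1)[OF that]] using ratio[OF that, of y] Min_ge_1
        by (auto intro!: mult_right_mono power_mono simp del: power_divide)
    qed (intro integrable_mult_right int Kx(1)[OF that])+
    finally show ?thesis .
  qed
  have Jup: "J p x \<le> (1 / real (Min A)) ^ p * J 0 x" if "x \<in> K" for p x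
  proof -
    have "J p x \<le> (\<integral>y. (1 / real (Min A)) ^ p * (g y ^ 0 * (1 + x * g y) powr (- (2 * s + real 0))) \<partial>M)"
      unfolding J_def
    proof (rule integral_mono)
      fix y
      show "g y ^ p * (1 + x * g y) powr (- (2 * s + real p))
          \<le> (1 / real (Min A)) ^ p * (g y ^ 0 * (1 + x * g y) powr (- (2 * s + real 0)))"
        unfolding split[OF Kx(1)[OF that]] using ratio[OF that, of y]
        by (auto intro!: mult_right_mono power_mono simp del: power_divide)
    qed (intro integrable_mult_right int Kx(1)[OF that])+
    also have "\<dots> = (1 / real (Min A)) ^ p * J 0 x"
      unfolding J_def by simp
    finally show ?thesis .
  qed
  have sgn: "(- 1) ^ p * F p x = c p * J p x" for p x
    by (simp add: F_def mult.assoc[symmetric] power_mult_distrib[symmetric])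
  have deriv: "(F p has_real_derivative F (Suc p) x) (at x within K)" if "x \<in> K" for p x
  proof -
    have "((\<lambda>x. J p x) has_real_derivative
       - (2 * s + real p) * (\<integral>y. g y ^ Suc p * (1 + x * g y) powr (- (2 * s + real p + 1)) \<partial>M)) (at x within {0..})"
      unfolding J_def using g Kx[OF that] s by (intro M.kernel_integral_deriv) auto
    also have "(\<integral>y. g y ^ Suc p * (1 + x * g y) powr (- (2 * s + real p + 1)) \<partial>M) = J (Suc p) x"
      unfolding J_def by (simp only: of_nat_Suc add.assoc add.commute[of 1])
    finally have "((\<lambda>x. (- 1) ^ p * c p * J p x) has_real_derivative
       (- 1) ^ p * c p * (- (2 * s + real p) * J (Suc p) x)) (at x within {0..})"
      by (rule DERIV_cmult)
    moreover have "(- 1) ^ p * c p * (- (2 * s + real p) * J (Suc p) x) = F (Suc p) x"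
      by (simp add: F_def c_def algebra_simps)
    ultimately have "(F p has_real_derivative F (Suc p) x) (at x within {0..})"
      by (simp add: F_def)
    then show ?thesis by (rule DERIV_subset) (auto simp: K_def)
  qed
  show ?thesis
  proof (rule that[of r F])
    show "(\<Sum>a\<in>A. (x + real a) powr (- 2 * s) * F 0 (theta a x)) = r * F 0 x" if "x \<in> K" for x
      using eig[OF that] unfolding F0 g_def .
    show "(\<Prod>i<p. 2 * s + real i) / (2 / real (Min A) + real (Max A)) ^ p * F 0 x \<le> (- 1) ^ p * F p x"
      if "x \<in> K" for p x
      using mult_left_mono[OF Jlow[OF that, of p] c[of p]] unfolding sgn J0
      by (simp add: c_def power_divide mult.assoc)
    show "(- 1) ^ p * F p x \<le> (\<Prod>i<p. 2 * s + real i) / real (Min A) ^ p * F 0 x"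
      if "x \<in> K" for p x
      using mult_left_mono[OF Jup[OF that, of p] c[of p]] unfolding sgn J0
      by (simp add: c_def power_divide mult.assoc)
  qed (use r F0_pos deriv in auto)
qed

end

section \<open>The spectral radius\<close>

lemma sup_norm_on_le:
  assumes "K \<noteq> {}" "\<And>x. x \<in> K \<Longrightarrow> norm (w x) \<le> B"
  shows "sup_norm_on K w \<le> B"
  unfolding sup_norm_on_def using assms by (intro cSUP_least)

lemma norm_le_sup_norm_on:
  assumes "compact K" "w \<in> cont_space K" "x \<in> K"
  shows "norm (w x) \<le> sup_norm_on K w"
proof -
  have "continuous_on K (\<lambda>x. norm (w x))"
    using assms(2) by (intro continuous_intros) (auto simp: cont_space_def)
  then have "bdd_above ((\<lambda>x. norm (w x)) ` K)"
    using assms(1) by (intro bounded_imp_bdd_above compact_imp_bounded compact_continuous_image)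
  then show ?thesis unfolding sup_norm_on_def using assms(3) by (intro cSUP_upper)
qed

context digits
begin

lemma compact_K: "compact K" and K_nonempty: "K \<noteq> {}"
  using zero_in_K by (auto simp: K_def)

lemma theta_in_K: "a \<in> A \<Longrightarrow> x \<in> K \<Longrightarrow> theta a x \<in> K"
  by (rule theta_K) (auto simp: K_def)

lemma cf_op_add: "cf_op s (\<lambda>x. w x + u x) = (\<lambda>x. cf_op s w x + cf_op s u x)"
  by (auto simp: cf_op_def fun_eq_iff scaleR_add_right sum.distrib)

lemma cf_op_scale: "cf_op s (\<lambda>x. c * w x) = (\<lambda>x. c * cf_op s w x)"
  by (auto simp: cf_op_def fun_eq_iff sum_distrib_left)

lemma cf_op_diff: "cf_op s (\<lambda>x. w x - u x) = (\<lambda>x. cf_op s w x - cf_op s u x)"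
  by (auto simp: cf_op_def fun_eq_iff scaleR_diff_right sum_subtractf)

lemma cf_op_iter_add: "(cf_op s ^^ n) (\<lambda>x. w x + u x) = (\<lambda>x. (cf_op s ^^ n) w x + (cf_op s ^^ n) u x)"
  by (induction n) (auto simp: cf_op_add)

lemma cf_op_iter_scale: "(cf_op s ^^ n) (\<lambda>x. c * w x) = (\<lambda>x. c * (cf_op s ^^ n) w x)"
  by (induction n) (auto simp: cf_op_scale)

lemma cf_op_iter_diff: "(cf_op s ^^ n) (\<lambda>x. w x - u x) = (\<lambda>x. (cf_op s ^^ n) w x - (cf_op s ^^ n) u x)"
  by (induction n) (auto simp: cf_op_diff)

lemma norm_cf_op_le:
  fixes w :: "real \<Rightarrow> 'a::real_normed_field"
  assumes "x \<in> K"
  shows "norm (cf_op s w x) \<le> (\<Sum>a\<in>A. (x + real a) powr (- 2 * s) * norm (w (theta a x)))"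
proof -
  have "norm (\<Sum>a\<in>A. ((x + real a) powr (- 2 * s)) *\<^sub>R w (theta a x))
      \<le> (\<Sum>a\<in>A. norm (((x + real a) powr (- 2 * s)) *\<^sub>R w (theta a x)))"
    by (rule norm_sum)
  then show ?thesis using assms by (simp add: cf_op_def)
qed

lemma cf_op_cont_space:
  assumes "w \<in> cont_space K"
  shows "cf_op s w \<in> cont_space K"
proof -
  have w: "continuous_on K w" using assms by (simp add: cont_space_def)
  have "continuous_on K (\<lambda>x. \<Sum>a\<in>A. ((x + real a) powr (- 2 * s)) *\<^sub>R w (theta a x))"
  proof (intro continuous_on_sum continuous_on_scaleR)
    fix a assume a: "a \<in> A"
    have nz: "x + real a \<noteq> 0" if "x \<in> K" for x using digit_ge_1[OF a] that by (auto simp: K_def)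
    then show "continuous_on K (\<lambda>x. (x + real a) powr (- 2 * s))"
      by (intro continuous_intros) auto
    have "continuous_on K (theta a)" unfolding theta_def using nz by (intro continuous_intros) auto
    then show "continuous_on K (\<lambda>x. w (theta a x))"
      using theta_in_K[OF a] by (intro continuous_on_compose2[OF w]) auto
  qed
  then have "continuous_on K (cf_op s w)"
    by (rule continuous_on_eq) (simp add: cf_op_def)
  then show ?thesis by (simp add: cont_space_def cf_op_def)
qed

lemma bounded_op_cf_op:
  assumes "s \<ge> 0"
  shows "bounded_op K (cf_op s)"
  unfolding bounded_op_def
proof (intro conjI ballI allI exI[of _ "real (card A)"])
  fix w :: "real \<Rightarrow> 'a" assume w: "w \<in> cont_space K"
  show "cf_op s w \<in> cont_space K" by (rule cf_op_cont_space[OF w])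
  show "sup_norm_on K (cf_op s w) \<le> real (card A) * sup_norm_on K w"
  proof (rule sup_norm_on_le[OF K_nonempty])
    fix x assume x: "x \<in> K"
    have "norm (cf_op s w x) \<le> (\<Sum>a\<in>A. (x + real a) powr (- 2 * s) * norm (w (theta a x)))"
      by (rule norm_cf_op_le[OF x])
    also have "\<dots> \<le> (\<Sum>a\<in>A. sup_norm_on K w)"
    proof (rule sum_mono)
      fix a assume a: "a \<in> A"
      have "x + real a \<ge> 1" using digit_ge_1[OF a] x by (simp add: K_def)
      then have "(x + real a) powr (- 2 * s) \<le> 1 powr (- 2 * s)"
        using assms by (intro powr_mono2') auto
      then have p: "(x + real a) powr (- 2 * s) \<le> 1" by (simp only: powr_one_eq_one)
      have "norm (w (theta a x)) \<le> sup_norm_on K w"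
        using x theta_K[OF a] by (intro norm_le_sup_norm_on[OF compact_K w]) (auto simp: K_def)
      then show "(x + real a) powr (- 2 * s) * norm (w (theta a x)) \<le> sup_norm_on K w"
        using mult_mono[OF p, of "norm (w (theta a x))" "sup_norm_on K w"] by simp
    qed
    finally show "norm (cf_op s w x) \<le> real (card A) * sup_norm_on K w" by simp
  qed
qed (simp_all add: cf_op_add cf_op_scale)

text \<open>Only values on \<open>K\<close> matter here, so the integral \<open>F 0\<close>, which
  is not cut off outside \<open>K\<close>, qualifies directly.\<close>

definition eigen :: "real \<Rightarrow> real \<Rightarrow> (real \<Rightarrow> real) \<Rightarrow> bool" where
  "eigen s r v \<longleftrightarrow> continuous_on K v \<and> (\<forall>x\<in>K. v x > 0) \<and>
     (\<forall>x\<in>K. (\<Sum>a\<in>A. (x + real a) powr (- 2 * s) * v (theta a x)) = r * v x)"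

lemma eigen_pos:
  assumes "eigen s r v"
  shows "r > 0"
proof -
  have "(\<Sum>a\<in>A. (0 + real a) powr (- 2 * s) * v (theta a 0)) > 0"
    using assms theta_K[of _ 0] digit_ge_1 unfolding eigen_def
    by (intro sum_pos fin ne mult_pos_pos) force+
  then have "r * v 0 > 0" "v 0 > 0" using assms zero_in_K unfolding eigen_def by auto
  then show ?thesis using zero_less_mult_pos2 by blast
qed

lemma eigen_bounds:
  assumes "eigen s r v"
  obtains l u where "l > 0" "u > 0" "\<And>x. x \<in> K \<Longrightarrow> l \<le> v x" "\<And>x. x \<in> K \<Longrightarrow> v x \<le> u"
proof -
  have v: "continuous_on K v" "\<And>x. x \<in> K \<Longrightarrow> v x > 0" using assms by (auto simp: eigen_def)
  obtain x0 where "x0 \<in> K" "\<forall>y\<in>K. v x0 \<le> v y"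
    using continuous_attains_inf[OF compact_K K_nonempty v(1)] by blast
  moreover obtain x1 where "x1 \<in> K" "\<forall>y\<in>K. v y \<le> v x1"
    using continuous_attains_sup[OF compact_K K_nonempty v(1)] by blast
  ultimately show ?thesis using v(2) by (intro that[of "v x0" "v x1"]) auto
qed

text \<open>In the norm weighted by \<open>1 / v\<close> the positive operator has norm at most
  \<open>r\<close>. This gives the exact rate \<open>r ^ n\<close> with the same constant
  \<open>C\<close> for all iterates, for complex functions as well.\<close>

lemma cf_op_iter_bound:
  fixes w :: "real \<Rightarrow> 'a::real_normed_field"
  assumes v: "eigen s r v" and w: "\<And>x. x \<in> K \<Longrightarrow> norm (w x) \<le> C * v x" and "x \<in> K"
  shows "norm ((cf_op s ^^ n) w x) \<le> C * r ^ n * v x"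
  using \<open>x \<in> K\<close>
proof (induction n arbitrary: x)
  case (Suc n)
  have "norm ((cf_op s ^^ Suc n) w x)
      \<le> (\<Sum>a\<in>A. (x + real a) powr (- 2 * s) * norm ((cf_op s ^^ n) w (theta a x)))"
    using norm_cf_op_le[OF Suc.prems] by simp
  also have "\<dots> \<le> (\<Sum>a\<in>A. (x + real a) powr (- 2 * s) * (C * r ^ n * v (theta a x)))"
    using Suc theta_K by (intro sum_mono) (auto simp: K_def intro!: mult_left_mono)
  also have "\<dots> = C * r ^ n * (\<Sum>a\<in>A. (x + real a) powr (- 2 * s) * v (theta a x))"
    unfolding sum_distrib_left by (intro sum.cong refl) simp
  also have "\<dots> = C * r ^ Suc n * v x"
    using v Suc.prems by (simp add: eigen_def)
  finally show ?case .
qed (use w in simp)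

lemma eigenvalue_in_spectrum:
  assumes v: "eigen s r v"
  shows "complex_of_real r \<in> op_spectrum K (cf_op s)"
proof -
  define u where "u = (\<lambda>x. if x \<in> K then complex_of_real (v x) else 0)"
  have vv: "continuous_on K v" "\<And>x. x \<in> K \<Longrightarrow> v x > 0"
      "\<And>x. x \<in> K \<Longrightarrow> (\<Sum>a\<in>A. (x + real a) powr (- 2 * s) * v (theta a x)) = r * v x"
    using v by (auto simp: eigen_def)
  have "continuous_on K (\<lambda>x. complex_of_real (v x))" using vv by (intro continuous_intros)
  then have "continuous_on K u" by (rule continuous_on_eq) (simp add: u_def)
  then have u: "u \<in> cont_space K" by (simp add: cont_space_def u_def)
  have eig: "cf_op s u = (\<lambda>x. complex_of_real r * u x)"
  proof (rule ext)
    fix x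
    show "cf_op s u x = complex_of_real r * u x"
    proof (cases "x \<in> K")
      case True
      then have "cf_op s u x = (\<Sum>a\<in>A. complex_of_real ((x + real a) powr (- 2 * s) * v (theta a x)))"
        using theta_K by (auto simp: cf_op_def u_def K_def scaleR_conv_of_real intro!: sum.cong)
      also have "\<dots> = complex_of_real (r * v x)" by (simp only: of_real_sum[symmetric] vv(3)[OF True])
      finally show ?thesis using True by (simp add: u_def)
    qed (simp add: cf_op_def u_def)
  qed
  show ?thesis unfolding op_spectrum_def
  proof (clarify)
    fix R assume R: "bounded_op K R" and inv: "\<forall>w\<in>cont_space K. R (\<lambda>x. complex_of_real r * w x - cf_op s w x) = w \<and>
       (\<lambda>x. complex_of_real r * R w x - cf_op s (R w) x) = w"
    \<comment> \<open>Homogeneity with the scalar 0 forces \<open>R 0 = 0\<close>, whereas a left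
      inverse would have to return the eigenfunction \<open>u\<close>.\<close>
    have "R (\<lambda>x. 0 * u x) = (\<lambda>x. 0 * R u x)" using R u unfolding bounded_op_def by blast
    then have "R (\<lambda>x. 0) = (\<lambda>x. 0)" by simp
    moreover have "R (\<lambda>x. complex_of_real r * u x - cf_op s u x) = u" using inv u by blast
    ultimately have "(\<lambda>x. 0) = u" by (simp add: eig)
    then have "u 0 = 0" by (auto dest: fun_cong)
    then show False using zero_in_K vv(2)[of 0] by (simp add: u_def)
  qed
qed

text \<open>The Neumann series of the inverse of \<open>z - cf_op s\<close>.\<close>

definition cf_resolvent :: "real \<Rightarrow> complex \<Rightarrow> (real \<Rightarrow> complex) \<Rightarrow> real \<Rightarrow> complex" where
  "cf_resolvent s z w x = (if x \<in> K then \<Sum>n. (cf_op s ^^ n) w x / z ^ Suc n else 0)"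

lemma neumann_bound:
  assumes v: "eigen s r v" and z: "cmod z > r"
  obtains D where "D > 0"
    "\<And>(w :: real \<Rightarrow> complex) x n. w \<in> cont_space K \<Longrightarrow> x \<in> K \<Longrightarrow>
      cmod ((cf_op s ^^ n) w x / z ^ Suc n) \<le> D * sup_norm_on K w * (r / cmod z) ^ n"
proof -
  obtain l u where lu: "l > 0" "u > 0" "\<And>x. x \<in> K \<Longrightarrow> l \<le> v x" "\<And>x. x \<in> K \<Longrightarrow> v x \<le> u"
    using eigen_bounds[OF v] by blast
  have r: "r > 0" by (rule eigen_pos[OF v])
  then have z0: "cmod z > 0" using z by linarith
  show ?thesis
  \<comment> \<open>The factor \<open>u / l\<close> converts between the norm weighted by
    \<open>1 / v\<close> and the supremum norm; \<open>1 / cmod z\<close> accounts for the exponent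
    \<open>Suc n\<close> in place of \<open>n\<close>.\<close>
  proof (rule that[of "u / l / cmod z"])
    fix w :: "real \<Rightarrow> complex" and x n assume w: "w \<in> cont_space K" and x: "x \<in> K"
    have s0: "sup_norm_on K w \<ge> 0"
      using norm_le_sup_norm_on[OF compact_K w x] norm_ge_zero order_trans by blast
    have "norm (w y) \<le> sup_norm_on K w / l * v y" if "y \<in> K" for y
    proof -
      have "norm (w y) \<le> sup_norm_on K w / l * l" using norm_le_sup_norm_on[OF compact_K w that] lu by simp
      also have "\<dots> \<le> sup_norm_on K w / l * v y" using lu s0 that by (intro mult_left_mono) auto
      finally show ?thesis .
    qed
    from cf_op_iter_bound[OF v this x, of n]
    have "cmod ((cf_op s ^^ n) w x) \<le> sup_norm_on K w / l * r ^ n * v x" .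
    also have "\<dots> \<le> sup_norm_on K w / l * r ^ n * u"
      using lu s0 r x by (intro mult_left_mono) auto
    finally have "cmod ((cf_op s ^^ n) w x) / cmod z ^ Suc n \<le> sup_norm_on K w / l * r ^ n * u / cmod z ^ Suc n"
      using z0 by (intro divide_right_mono) auto
    then show "cmod ((cf_op s ^^ n) w x / z ^ Suc n) \<le> u / l / cmod z * sup_norm_on K w * (r / cmod z) ^ n"
      by (simp add: norm_divide norm_mult norm_power power_divide mult_ac)
  qed (use lu z0 in simp)
qed

lemma resolvent_outside_spectral_radius:
  assumes v: "eigen s r v" and z: "cmod z > r"
  shows "z \<notin> op_spectrum K (cf_op s)"
proof -
  obtain D where D: "D > 0" "\<And>(w :: real \<Rightarrow> complex) x n. w \<in> cont_space K \<Longrightarrow> x \<in> K \<Longrightarrow>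
      cmod ((cf_op s ^^ n) w x / z ^ Suc n) \<le> D * sup_norm_on K w * (r / cmod z) ^ n"
    by (rule neumann_bound[OF v z]) (rule that)
  have r: "r > 0" by (rule eigen_pos[OF v])
  then have z0: "cmod z > 0" using z by linarith
  define q where "q = r / cmod z"
  have q: "0 < q" "q < 1" using r z z0 by (auto simp: q_def)
  have gsum: "summable (\<lambda>n. c * q ^ n)" for c using q by (intro summable_mult summable_geometric) auto
  have bd: "cmod ((cf_op s ^^ n) w x / z ^ Suc n) \<le> D * sup_norm_on K w * q ^ n"
    if "w \<in> cont_space K" "x \<in> K" for w x n
    unfolding q_def by (rule D(2)[OF that])
  have summ: "summable (\<lambda>n. (cf_op s ^^ n) w x / z ^ Suc n)" if "w \<in> cont_space K" "x \<in> K" for w x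
    by (rule summable_comparison_test'[OF gsum bd[OF that]])
  have Rcont: "cf_resolvent s z w \<in> cont_space K" if w: "w \<in> cont_space K" for w
  proof -
    have iter: "(cf_op s ^^ n) w \<in> cont_space K" for n
      using w by (induction n) (auto intro: cf_op_cont_space)
    have "uniform_limit K (\<lambda>n x. \<Sum>i<n. (cf_op s ^^ i) w x / z ^ Suc i)
       (\<lambda>x. \<Sum>i. (cf_op s ^^ i) w x / z ^ Suc i) sequentially"
      by (rule Weierstrass_m_test[OF bd[OF w] gsum])
    moreover have "continuous_on K (\<lambda>x. \<Sum>i<n. (cf_op s ^^ i) w x / z ^ Suc i)" for n
    proof (intro continuous_on_sum continuous_on_divide continuous_on_const ballI)
      show "continuous_on K ((cf_op s ^^ i) w)" for i using iter[of i] by (simp add: cont_space_def)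
    qed (use z0 in auto)
    ultimately have "continuous_on K (\<lambda>x. \<Sum>i. (cf_op s ^^ i) w x / z ^ Suc i)"
      by (intro uniform_limit_theorem) auto
    then have "continuous_on K (cf_resolvent s z w)"
      by (rule continuous_on_eq) (simp add: cf_resolvent_def)
    then show ?thesis by (simp add: cont_space_def cf_resolvent_def)
  qed
  \<comment> \<open>Both inverse identities reduce to this telescoping series. Its terms are those
    of \<open>z\<close> times the resolvent minus those of the series with \<open>cf_op s\<close>
    applied once more.\<close>
  have tele: "(\<lambda>n. z * ((cf_op s ^^ n) w x / z ^ Suc n) - (cf_op s ^^ Suc n) w x / z ^ Suc n) sums w x"
    if w: "w \<in> cont_space K" and x: "x \<in> K" for w x
  proof -
    have "(\<lambda>n. (cf_op s ^^ n) w x / z ^ Suc n) \<longlonglongrightarrow> 0" by (rule summable_LIMSEQ_zero[OF summ[OF that]])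
    then have "(\<lambda>n. z * ((cf_op s ^^ n) w x / z ^ Suc n)) \<longlonglongrightarrow> z * 0" by (intro tendsto_mult tendsto_const)
    then have "(\<lambda>n. (cf_op s ^^ n) w x / z ^ n) \<longlonglongrightarrow> 0" using z0 by simp
    from telescope_sums'[OF this]
    have "(\<lambda>n. (cf_op s ^^ n) w x / z ^ n - (cf_op s ^^ Suc n) w x / z ^ Suc n) sums (w x)" by simp
    then show ?thesis using z0 by simp
  qed
  have summ': "summable (\<lambda>n. (cf_op s ^^ Suc n) w x / z ^ Suc n)" if "w \<in> cont_space K" "x \<in> K" for w x
  proof -
    have "summable (\<lambda>n. z * ((cf_op s ^^ Suc n) w x / z ^ Suc (Suc n)))"
      using summ[OF that] summable_Suc_iff[of "\<lambda>n. (cf_op s ^^ n) w x / z ^ Suc n"]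
      by (intro summable_mult) blast
    then show ?thesis using z0 by simp
  qed
  have bop: "bounded_op K (cf_resolvent s z)"
    unfolding bounded_op_def
  proof (intro conjI ballI allI exI[of _ "D / (1 - q)"])
    fix w u :: "real \<Rightarrow> complex" and c assume w: "w \<in> cont_space K"
    show "cf_resolvent s z w \<in> cont_space K" by (rule Rcont[OF w])
    show "cf_resolvent s z (\<lambda>x. c * w x) = (\<lambda>x. c * cf_resolvent s z w x)"
      using suminf_mult[OF summ[OF w]]
      by (auto simp: cf_resolvent_def fun_eq_iff cf_op_iter_scale)
    show "sup_norm_on K (cf_resolvent s z w) \<le> D / (1 - q) * sup_norm_on K w"
    proof (rule sup_norm_on_le[OF K_nonempty])
      fix x assume x: "x \<in> K"
      have "cmod (cf_resolvent s z w x) \<le> (\<Sum>n. D * sup_norm_on K w * q ^ n)"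
        using x norm_suminf_le[OF bd[OF w x] gsum] by (simp add: cf_resolvent_def)
      also have "\<dots> = D * sup_norm_on K w * (1 / (1 - q))"
        using q by (subst suminf_mult) (auto simp: suminf_geometric)
      finally show "cmod (cf_resolvent s z w x) \<le> D / (1 - q) * sup_norm_on K w" by simp
    qed
    assume u: "u \<in> cont_space K"
    show "cf_resolvent s z (\<lambda>x. w x + u x) = (\<lambda>x. cf_resolvent s z w x + cf_resolvent s z u x)"
      using suminf_add[OF summ[OF w] summ[OF u]]
      by (auto simp: cf_resolvent_def fun_eq_iff cf_op_iter_add add_divide_distrib)
  qed
  have left: "cf_resolvent s z (\<lambda>x. z * w x - cf_op s w x) = w" if w: "w \<in> cont_space K" for w
  proof (rule ext)
    fix x
    show "cf_resolvent s z (\<lambda>x. z * w x - cf_op s w x) x = w x"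
    proof (cases "x \<in> K")
      case True
      have "(cf_op s ^^ n) (\<lambda>x. z * w x - cf_op s w x) x / z ^ Suc n =
          z * ((cf_op s ^^ n) w x / z ^ Suc n) - (cf_op s ^^ Suc n) w x / z ^ Suc n" for n
        by (simp add: cf_op_iter_diff cf_op_iter_scale funpow_swap1 diff_divide_distrib)
      then show ?thesis using True sums_unique[OF tele[OF w True]] by (simp add: cf_resolvent_def)
    next
      case False
      then show ?thesis using w by (simp add: cf_resolvent_def cont_space_def)
    qed
  qed
  have right: "(\<lambda>x. z * cf_resolvent s z w x - cf_op s (cf_resolvent s z w) x) = w" if w: "w \<in> cont_space K" for w
  proof (rule ext)
    fix x
    show "z * cf_resolvent s z w x - cf_op s (cf_resolvent s z w) x = w x"
    proof (cases "x \<in> K")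
      case True
      have th: "theta a x \<in> K" if "a \<in> A" for a using True theta_K[OF that] by (simp add: K_def)
      have "cf_op s (cf_resolvent s z w) x =
          (\<Sum>a\<in>A. ((x + real a) powr (- 2 * s)) *\<^sub>R (\<Sum>n. (cf_op s ^^ n) w (theta a x) / z ^ Suc n))"
        using True th by (simp add: cf_op_def cf_resolvent_def)
      also have "\<dots> = (\<Sum>a\<in>A. \<Sum>n. ((x + real a) powr (- 2 * s)) *\<^sub>R ((cf_op s ^^ n) w (theta a x) / z ^ Suc n))"
        using summ[OF w th] by (intro sum.cong refl suminf_scaleR_right)
      also have "\<dots> = (\<Sum>n. \<Sum>a\<in>A. ((x + real a) powr (- 2 * s)) *\<^sub>R ((cf_op s ^^ n) w (theta a x) / z ^ Suc n))"
        using summ[OF w th] by (intro suminf_sum[symmetric] summable_scaleR_right)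
      also have "\<dots> = (\<Sum>n. (cf_op s ^^ Suc n) w x / z ^ Suc n)"
        using True by (simp add: cf_op_def sum_divide_distrib scaleR_conv_of_real)
      finally have "z * cf_resolvent s z w x - cf_op s (cf_resolvent s z w) x =
         (\<Sum>n. z * ((cf_op s ^^ n) w x / z ^ Suc n)) - (\<Sum>n. (cf_op s ^^ Suc n) w x / z ^ Suc n)"
        using True suminf_mult[OF summ[OF w True], of z] by (simp add: cf_resolvent_def)
      also have "\<dots> = (\<Sum>n. z * ((cf_op s ^^ n) w x / z ^ Suc n) - (cf_op s ^^ Suc n) w x / z ^ Suc n)"
        by (rule suminf_diff[OF summable_mult[OF summ[OF w True]] summ'[OF w True]])
      also have "\<dots> = w x" by (rule sums_unique[OF tele[OF w True], symmetric])
      finally show ?thesis .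
    next
      case False
      then show ?thesis using w by (simp add: cf_resolvent_def cont_space_def cf_op_def)
    qed
  qed
  show ?thesis unfolding op_spectrum_def using bop left right by blast
qed

text \<open>Besides computing the radius, this shows that all positive eigenfunctions belong to the
  same eigenvalue, which is the first half of uniqueness.\<close>

lemma spectral_radius_eq:
  assumes v: "eigen s r v"
  shows "op_spectral_radius K (cf_op s) = r"
  unfolding op_spectral_radius_def
proof (rule cSup_eq_maximum)
  show "r \<in> cmod ` op_spectrum K (cf_op s)"
    using eigenvalue_in_spectrum[OF v] eigen_pos[OF v] by (force intro: image_eqI[of _ _ "complex_of_real r"])
  show "x \<le> r" if "x \<in> cmod ` op_spectrum K (cf_op s)" for x
    using that resolvent_outside_spectral_radius[OF v] by force
qed

end

section \<open>Uniqueness of the eigenfunction and dependence on the exponent\<close>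

text \<open>Growth rates can thus be compared while ignoring constant factors such as
  \<open>4 powr s\<close>.\<close>

lemma power_le_const_mult_imp_le:
  fixes x y c :: real
  assumes "x > 0" "y > 0" "\<And>n. x ^ n \<le> c * y ^ n"
  shows "x \<le> y"
proof (rule ccontr)
  assume "\<not> x \<le> y"
  then have "x / y > 1" using assms by simp
  then obtain n where "c < (x / y) ^ n" using real_arch_pow by blast
  then have "c * y ^ n < x ^ n" using assms by (simp add: power_divide less_divide_eq)
  then show False using assms(3)[of n] by simp
qed

context digits
begin

lemma cf_map_close:
  assumes "w \<in> words n" "x \<in> {0..1}" "y \<in> {0..1}"
  shows "\<bar>cf_map w x - cf_map w y\<bar> \<le> 1 / (cf_den w 0)\<^sup>2"
    "\<bar>cf_map w x - cf_map w y\<bar> \<le> (1 / 2) ^ (n div 2)"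
proof -
  have w: "0 \<notin> set w" by (rule words_not0[OF assms(1)])
  have q: "cf_den w 0 > 0" "1 \<le> cf_den w 0" "2 ^ (n div 2) \<le> cf_den w 0"
    using cf_den_pos[OF w] cf_den_ge_1[OF w] cf_den_growth[OF w, of 0] length_words[OF assms(1)] by auto
  have "\<bar>cf_map w x - cf_map w y\<bar> = \<bar>x - y\<bar> / (cf_den w x * cf_den w y)"
    using assms by (intro cf_map_diff[OF w]) auto
  also have "\<dots> \<le> 1 / (cf_den w 0 * cf_den w 0)"
    using cf_den_le(1)[OF w assms(2)] cf_den_le(1)[OF w assms(3)] q assms(2,3)
    by (intro frac_le mult_mono) auto
  finally show le: "\<bar>cf_map w x - cf_map w y\<bar> \<le> 1 / (cf_den w 0)\<^sup>2" by (simp add: power2_eq_square)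
  have "2 ^ (n div 2) * 1 \<le> cf_den w 0 * cf_den w 0" using q by (intro mult_mono) auto
  then have "1 / (cf_den w 0)\<^sup>2 \<le> 1 / 2 ^ (n div 2)"
    using q by (intro divide_left_mono) (auto simp: power2_eq_square)
  then show "\<bar>cf_map w x - cf_map w y\<bar> \<le> (1 / 2) ^ (n div 2)" using le by (simp add: power_divide)
qed

text \<open>A maximum principle: \<open>w - c * v\<close> is nonnegative and vanishes at
  \<open>x\<close>, so its image under the operator also vanishes there. That image is a sum of
  nonnegative terms with positive weights, hence each term is 0.\<close>

lemma eigen_touching:
  assumes v: "eigen s r v" and w: "eigen s r w"
    and le: "\<And>y. y \<in> K \<Longrightarrow> c * v y \<le> w y" and eq: "w x = c * v x" and x: "x \<in> K" and a: "a \<in> A"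
  shows "w (theta a x) = c * v (theta a x)"
proof -
  have pos: "(x + real b) powr (- 2 * s) > 0" if "b \<in> A" for b
  proof -
    have "x + real b > 0" using digit_ge_1[OF that] x by (auto simp: K_def)
    then show ?thesis by simp
  qed
  have "(\<Sum>b\<in>A. (x + real b) powr (- 2 * s) * (w (theta b x) - c * v (theta b x)))
      = (\<Sum>b\<in>A. (x + real b) powr (- 2 * s) * w (theta b x)) - c * (\<Sum>b\<in>A. (x + real b) powr (- 2 * s) * v (theta b x))"
    unfolding sum_distrib_left sum_subtractf[symmetric] by (intro sum.cong refl) (simp add: algebra_simps)
  also have "\<dots> = r * w x - c * (r * v x)" using v w x by (simp add: eigen_def)
  also have "\<dots> = 0" using eq by simp
  finally have "(\<Sum>b\<in>A. (x + real b) powr (- 2 * s) * (w (theta b x) - c * v (theta b x))) = 0" .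
  moreover have "(x + real b) powr (- 2 * s) * (w (theta b x) - c * v (theta b x)) \<ge> 0" if "b \<in> A" for b
    using pos[OF that] le[OF theta_in_K[OF that x]] by simp
  ultimately have "(x + real a) powr (- 2 * s) * (w (theta a x) - c * v (theta a x)) = 0"
    using a by (simp add: sum_nonneg_eq_0_iff fin)
  then show ?thesis using pos[OF a] by simp
qed

lemma replicate_words: "a \<in> A \<Longrightarrow> replicate n a \<in> words n"
  by (auto simp: words_def)

lemma eigen_touching_iter:
  assumes v: "eigen s r v" and w: "eigen s r w"
    and le: "\<And>y. y \<in> K \<Longrightarrow> c * v y \<le> w y" and eq: "w x = c * v x" and x: "x \<in> K" and a: "a \<in> A"
  shows "w (cf_map (replicate n a) x) = c * v (cf_map (replicate n a) x)"
proof (induction n)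
  case (Suc n)
  show ?case
    using eigen_touching[OF v w le Suc cf_map_K[OF replicate_words[OF a] x] a] by simp
qed (use eq in simp)

text \<open>
  The extremal values of \<open>w / v\<close> propagate along orbits of the maps. Orbits started at a minimum point
  and at a maximum point come together, so the two values agree.
\<close>

lemma eigen_unique:
  assumes v: "eigen s r v" and w: "eigen s r' w"
  shows "\<exists>c>0. \<forall>x\<in>K. w x = c * v x"
proof -
  have rr: "r' = r" using spectral_radius_eq[OF v] spectral_radius_eq[OF w] by simp
  note w = w[unfolded rr]
  have vp: "v x > 0" and wp: "w x > 0" if "x \<in> K" for x using v w that by (auto simp: eigen_def)
  define f where "f = (\<lambda>x. w x / v x)"
  have f: "continuous_on K f"
    unfolding f_def using v w vp by (intro continuous_intros) (auto simp: eigen_def dest: vp)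
  obtain x0 where x0: "x0 \<in> K" "\<And>y. y \<in> K \<Longrightarrow> f x0 \<le> f y"
    using continuous_attains_inf[OF compact_K K_nonempty f] by blast
  obtain x1 where x1: "x1 \<in> K" "\<And>y. y \<in> K \<Longrightarrow> f y \<le> f x1"
    using continuous_attains_sup[OF compact_K K_nonempty f] by blast
  obtain a where a: "a \<in> A" using ne by blast
  define u where "u = (\<lambda>n. replicate n a)"
  have u: "u n \<in> words n" for n unfolding u_def by (rule replicate_words[OF a])
  have le0: "f x0 * v y \<le> w y" if "y \<in> K" for y
    using x0(2)[OF that] vp[OF that] by (simp add: f_def le_divide_eq)
  \<comment> \<open>The maximum of \<open>w / v\<close> is treated as a minimum by exchanging
    \<open>v\<close> and \<open>w\<close> and inverting the constant.\<close>
  have le1: "1 / f x1 * w y \<le> v y" if "y \<in> K" for y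
    using x1(2)[OF that] vp[OF that] wp[OF that] vp[OF x1(1)] wp[OF x1(1)]
    by (simp add: f_def field_simps)
  have eq0: "f (cf_map (u n) x0) = f x0" for n
  proof -
    have "w (cf_map (u n) x0) = f x0 * v (cf_map (u n) x0)"
      unfolding u_def using le0 x0(1) vp[OF x0(1)] a
      by (intro eigen_touching_iter[OF v w]) (auto simp: f_def)
    then show ?thesis using vp[OF cf_map_K[OF u x0(1)], of n] by (simp add: f_def)
  qed
  have eq1: "f (cf_map (u n) x1) = f x1" for n
  proof -
    have "v (cf_map (u n) x1) = 1 / f x1 * w (cf_map (u n) x1)"
      unfolding u_def using le1 x1(1) wp[OF x1(1)] vp[OF x1(1)] a
      by (intro eigen_touching_iter[OF w v]) (auto simp: f_def)
    then show ?thesis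
      using wp[OF cf_map_K[OF u x1(1)], of n] vp[OF cf_map_K[OF u x1(1)], of n] wp[OF x1(1)] vp[OF x1(1)]
      by (simp add: f_def field_simps)
  qed
  have "f x0 = f x1"
  proof (rule ccontr)
    assume "f x0 \<noteq> f x1"
    then have e: "dist (f x0) (f x1) > 0" by simp
    obtain d where d: "d > 0" "\<And>x y. x \<in> K \<Longrightarrow> y \<in> K \<Longrightarrow> dist y x < d \<Longrightarrow> dist (f y) (f x) < dist (f x0) (f x1)"
      using compact_uniformly_continuous[OF f compact_K] e unfolding uniformly_continuous_on_def by metis
    obtain k where k: "(1 / 2) ^ k < d" using real_arch_pow_inv[OF d(1), of "1/2"] by auto
    let ?w = "u (2 * k)"
    have "dist (cf_map ?w x0) (cf_map ?w x1) < d"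
      using cf_map_close(2)[OF u K_unit[OF x0(1)] K_unit[OF x1(1)], of "2 * k"] k by (simp add: dist_real_def)
    then have "dist (f (cf_map ?w x0)) (f (cf_map ?w x1)) < dist (f x0) (f x1)"
      by (intro d(2) cf_map_K[OF u] x0(1) x1(1))
    then show False by (simp add: eq0 eq1)
  qed
  then have "w x = f x0 * v x" if "x \<in> K" for x
    using x0(2)[OF that] x1(2)[OF that] vp[OF that] by (simp add: f_def field_simps)
  moreover have "f x0 > 0" using wp[OF x0(1)] vp[OF x0(1)] by (simp add: f_def)
  ultimately show ?thesis by blast
qed

section \<open>The spectral radius as a function of the exponent\<close>

definition lam :: "real \<Rightarrow> real" where "lam s = op_spectral_radius K (cf_op s)"

lemma eigenfunction_lam:
  assumes s: "s \<ge> 0"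
  obtains F where "lam s > 0" "eigen s (lam s) (F 0)"
    "\<And>p x. x \<in> K \<Longrightarrow> (F p has_real_derivative F (Suc p) x) (at x within K)"
    "\<And>p x. x \<in> K \<Longrightarrow>
      (\<Prod>i<p. 2 * s + real i) / (2 / real (Min A) + real (Max A)) ^ p * F 0 x \<le> (- 1) ^ p * F p x"
    "\<And>p x. x \<in> K \<Longrightarrow> (- 1) ^ p * F p x \<le> (\<Prod>i<p. 2 * s + real i) / real (Min A) ^ p * F 0 x"
    "\<And>n. lam s ^ n \<le> psum s n" "\<And>n. 4 powr (- s) * psum s n \<le> lam s ^ n"
proof -
  obtain r F where r: "r > 0" "\<And>n. n \<ge> 1 \<Longrightarrow> r ^ n \<le> psum s n"
      "\<And>n. n \<ge> 1 \<Longrightarrow> 4 powr (- s) * psum s n \<le> r ^ n"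
    and F: "\<And>x. x \<in> K \<Longrightarrow> F 0 x > 0"
    "\<And>x. x \<in> K \<Longrightarrow> (\<Sum>a\<in>A. (x + real a) powr (- 2 * s) * F 0 (theta a x)) = r * F 0 x"
    "\<And>p x. x \<in> K \<Longrightarrow> (F p has_real_derivative F (Suc p) x) (at x within K)"
    "\<And>p x. x \<in> K \<Longrightarrow>
      (\<Prod>i<p. 2 * s + real i) / (2 / real (Min A) + real (Max A)) ^ p * F 0 x \<le> (- 1) ^ p * F p x"
    "\<And>p x. x \<in> K \<Longrightarrow> (- 1) ^ p * F p x \<le> (\<Prod>i<p. 2 * s + real i) / real (Min A) ^ p * F 0 x"
    by (rule eigenfunction_exists[OF s]) (rule that)
  have "continuous_on K (F 0)"
    using F(3) by (auto simp: continuous_on_eq_continuous_within intro: DERIV_continuous)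
  then have e: "eigen s r (F 0)" using F by (simp add: eigen_def)
  then have lam: "lam s = r" unfolding lam_def by (rule spectral_radius_eq)
  \<comment> \<open>The growth bounds were obtained for \<open>n \<ge> 1\<close>; the empty word
    settles \<open>n = 0\<close>, where both sums are 1 and the constant is at most 1.\<close>
  have p0: "psum s 0 = 1" by (simp add: psum_def)
  have c1: "(4::real) powr (- s) \<le> 1"
    using s by (simp add: powr_minus field_simps ge_one_powr_ge_zero)
  show ?thesis
  proof (rule that[of F])
    show "lam s ^ n \<le> psum s n" for n using r(2)[of n] p0 lam by (cases n) auto
    show "4 powr (- s) * psum s n \<le> lam s ^ n" for n using r(3)[of n] p0 lam c1 by (cases n) auto
  qed (use e F r lam in auto)
qed

lemma lam_pos: "s \<ge> 0 \<Longrightarrow> lam s > 0"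
  by (rule eigenfunction_lam[of s])

lemma lam_psum:
  assumes "s \<ge> 0"
  shows "lam s ^ n \<le> psum s n" "psum s n \<le> 4 powr s * lam s ^ n"
proof -
  have "4 powr (- s) * psum s n \<le> lam s ^ n"
    by (rule eigenfunction_lam[OF assms])
  then show "psum s n \<le> 4 powr s * lam s ^ n" by (simp add: powr_minus field_simps)
  show "lam s ^ n \<le> psum s n" by (rule eigenfunction_lam[OF assms])
qed

text \<open>At exponent 0 the constant 1 is an eigenfunction. The value is at least 1 and serves as
  the starting point for the intermediate value theorem.\<close>

lemma lam_0: "lam 0 = card A"
  unfolding lam_def
proof (rule spectral_radius_eq)
  have "(x + real a) powr 0 = 1" if "x \<in> K" "a \<in> A" for x a
    using that digit_ge_1[OF that(2)] by (auto simp: K_def)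
  then show "eigen 0 (real (card A)) (\<lambda>_. 1)" by (simp add: eigen_def)
qed

text \<open>Words of length \<open>2 * n\<close> have denominators at least \<open>2 ^ n\<close>, so
  raising the exponent by \<open>t - s\<close> shrinks every summand by
  \<open>(2 powr (- (t - s))) ^ (2 * n)\<close>. Restricting to even lengths avoids rounding, and
  therefore squares are compared first.\<close>

lemma lam_upper:
  assumes "0 \<le> s" "s \<le> t"
  shows "lam t \<le> 2 powr (- (t - s)) * lam s"
proof -
  have pos: "lam s > 0" "lam t > 0" using lam_pos assms by auto
  have "(lam t ^ 2) ^ n \<le> 4 powr s * ((2 powr (- (t - s)) * lam s) ^ 2) ^ n" for n
  proof -
    have "(lam t ^ 2) ^ n = lam t ^ (2 * n)" by (simp add: power_mult)
    also have "\<dots> \<le> psum t (2 * n)" using assms by (intro lam_psum) auto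
    also have "\<dots> \<le> (\<Sum>w\<in>words (2 * n). (2 powr (- (t - s))) ^ (2 * n) * cf_den w 0 powr (- 2 * s))"
      unfolding psum_def
    proof (rule sum_mono)
      fix w assume w: "w \<in> words (2 * n)"
      have g: "2 ^ n \<le> cf_den w 0"
        using cf_den_growth[OF words_not0[OF w], of 0] length_words[OF w] by simp
      then have "cf_den w 0 powr (- 2 * (t - s)) \<le> (2 ^ n) powr (- 2 * (t - s))"
        using assms by (intro powr_mono2') auto
      also have "\<dots> = (2 powr (- (t - s))) ^ (2 * n)"
        by (simp add: powr_realpow[symmetric] powr_powr algebra_simps)
      finally have "cf_den w 0 powr (- 2 * (t - s)) * cf_den w 0 powr (- 2 * s)
          \<le> (2 powr (- (t - s))) ^ (2 * n) * cf_den w 0 powr (- 2 * s)"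
        by (intro mult_right_mono) auto
      moreover have "cf_den w 0 powr (- 2 * (t - s)) * cf_den w 0 powr (- 2 * s) = cf_den w 0 powr (- 2 * t)"
        by (simp add: powr_add[symmetric] algebra_simps)
      ultimately show "cf_den w 0 powr (- 2 * t) \<le> (2 powr (- (t - s))) ^ (2 * n) * cf_den w 0 powr (- 2 * s)"
        by simp
    qed
    also have "\<dots> = (2 powr (- (t - s))) ^ (2 * n) * psum s (2 * n)"
      by (simp only: psum_def sum_distrib_left)
    also have "\<dots> \<le> (2 powr (- (t - s))) ^ (2 * n) * (4 powr s * lam s ^ (2 * n))"
      using assms by (intro mult_left_mono lam_psum) auto
    also have "\<dots> = 4 powr s * ((2 powr (- (t - s)) * lam s) ^ 2) ^ n"
      by (simp only: power_mult[symmetric] power_mult_distrib mult_ac)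
    finally show ?thesis .
  qed
  note * = this
  have "lam t ^ 2 \<le> (2 powr (- (t - s)) * lam s) ^ 2"
    by (rule power_le_const_mult_imp_le[OF _ _ *]) (use pos in auto)
  then show ?thesis using pos by (simp add: power2_le_iff_abs_le)
qed

lemma cf_den_upper: "w \<in> words n \<Longrightarrow> cf_den w 0 \<le> (real (Max A) + 1) ^ n"
proof (induction n arbitrary: w)
  case (Suc n)
  then obtain a u where w: "w = a # u" "a \<in> A" "u \<in> words n" by (auto simp: words_Suc)
  have "cf_map u 0 \<le> 1" using cf_map_unit[OF words_not0[OF w(3)], of 0] by simp
  moreover have "real a \<le> real (Max A)" using w fin by simp
  moreover have "cf_map u 0 \<ge> 0" using cf_map_nonneg[OF words_not0[OF w(3)], of 0] by simp
  ultimately have "cf_den u 0 * (cf_map u 0 + real a) \<le> (real (Max A) + 1) ^ n * (real (Max A) + 1)"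
    using Suc.IH[OF w(3)] by (intro mult_mono) auto
  then show ?case by (simp add: w mult.commute)
qed simp

text \<open>The companion estimate: each letter multiplies a denominator by at most
  \<open>Max A + 1\<close>, so no summand can shrink faster than this rate. It supplies
  continuity.\<close>

lemma lam_lower:
  assumes "0 \<le> s" "s \<le> t"
  shows "(real (Max A) + 1) powr (- 2 * (t - s)) * lam s \<le> lam t"
proof -
  let ?G = "real (Max A) + 1"
  have pos: "lam s > 0" "lam t > 0" using lam_pos assms by auto
  show ?thesis
  proof (rule power_le_const_mult_imp_le)
    fix n
    have "(?G powr (- 2 * (t - s)) * lam s) ^ n \<le> (?G powr (- 2 * (t - s))) ^ n * psum s n"
      unfolding power_mult_distrib using assms by (intro mult_left_mono lam_psum) auto
    also have "\<dots> = (\<Sum>w\<in>words n. (?G powr (- 2 * (t - s))) ^ n * cf_den w 0 powr (- 2 * s))"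
      by (simp only: psum_def sum_distrib_left)
    also have "\<dots> \<le> psum t n"
      unfolding psum_def
    proof (rule sum_mono)
      fix w assume w: "w \<in> words n"
      have "(?G powr (- 2 * (t - s))) ^ n = (?G ^ n) powr (- 2 * (t - s))"
        by (simp add: powr_realpow[symmetric] powr_powr mult.commute)
      also have "\<dots> \<le> cf_den w 0 powr (- 2 * (t - s))"
        using assms cf_den_upper[OF w] cf_den_pos[OF words_not0[OF w], of 0] by (intro powr_mono2') auto
      finally have "(?G powr (- 2 * (t - s))) ^ n * cf_den w 0 powr (- 2 * s)
          \<le> cf_den w 0 powr (- 2 * (t - s)) * cf_den w 0 powr (- 2 * s)"
        by (intro mult_right_mono) auto
      also have "\<dots> = cf_den w 0 powr (- 2 * t)"
        by (simp add: powr_add[symmetric] algebra_simps)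
      finally show "(?G powr (- 2 * (t - s))) ^ n * cf_den w 0 powr (- 2 * s) \<le> cf_den w 0 powr (- 2 * t)" .
    qed
    also have "\<dots> \<le> 4 powr t * lam t ^ n" using assms by (intro lam_psum) auto
    finally show "(?G powr (- 2 * (t - s)) * lam s) ^ n \<le> 4 powr t * lam t ^ n" .
  qed (use pos in auto)
qed

lemma lam_strict:
  assumes "0 \<le> s" "s < t"
  shows "lam t < lam s"
proof -
  have "2 powr (- (t - s)) < (2::real) powr 0" using assms by (intro powr_less_mono) auto
  then have "2 powr (- (t - s)) * lam s < 1 * lam s"
    using lam_pos[OF assms(1)] by (intro mult_strict_right_mono) auto
  then show ?thesis using lam_upper[of s t] assms by linarith
qed

lemma lam_continuous: "continuous_on {0..} lam"
proof -
  let ?G = "real (Max A) + 1"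
  \<comment> \<open>Bounding \<open>lam s\<close> by \<open>lam 0\<close> makes the modulus of
    continuity depend on \<open>t - s\<close> alone.\<close>
  have diff: "\<bar>lam t - lam s\<bar> \<le> lam 0 * (1 - ?G powr (- 2 * \<bar>t - s\<bar>))" if "0 \<le> s" "0 \<le> t" for s t
  proof -
    have *: "\<bar>lam t - lam s\<bar> \<le> lam 0 * (1 - ?G powr (- 2 * (t - s)))" if "0 \<le> s" "s \<le> t" for s t
    proof -
      have "lam t \<le> lam s" using lam_strict[of s t] that by (cases "s = t") auto
      moreover have "lam s \<le> lam 0" using lam_strict[of 0 s] that by (cases "s = 0") auto
      moreover have "lam s - lam t \<le> lam s * (1 - ?G powr (- 2 * (t - s)))"
        using lam_lower[OF that] by (simp add: algebra_simps)
      moreover have "?G powr (- 2 * (t - s)) \<le> ?G powr 0" using that by (intro powr_mono) auto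
      then have "?G powr (- 2 * (t - s)) \<le> 1" by (simp add: add_nonneg_eq_0_iff)
      then have "lam s * (1 - ?G powr (- 2 * (t - s))) \<le> lam 0 * (1 - ?G powr (- 2 * (t - s)))"
        using \<open>lam s \<le> lam 0\<close> by (intro mult_right_mono) auto
      ultimately show ?thesis by simp
    qed
    show ?thesis
    proof (cases "s \<le> t")
      case True
      then show ?thesis using *[of s t] that by simp
    next
      case False
      then show ?thesis using *[of t s] that by (simp add: abs_minus_commute)
    qed
  qed
  show ?thesis unfolding continuous_on_def
  proof
    fix s :: real assume s: "s \<in> {0..}"
    have "((\<lambda>t. lam 0 * (1 - ?G powr (- 2 * \<bar>t - s\<bar>))) \<longlongrightarrow> lam 0 * (1 - ?G powr (- 2 * \<bar>s - s\<bar>))) (at s within {0..})"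
      by (intro tendsto_intros) (auto simp: add_nonneg_eq_0_iff)
    then have "((\<lambda>t. lam 0 * (1 - ?G powr (- 2 * \<bar>t - s\<bar>))) \<longlongrightarrow> 0) (at s within {0..})"
      by (simp add: add_nonneg_eq_0_iff)
    moreover have "\<forall>\<^sub>F t in at s within {0..}. norm (lam t - lam s) \<le> lam 0 * (1 - ?G powr (- 2 * \<bar>t - s\<bar>))"
      using diff s by (auto simp: eventually_at_filter)
    ultimately have "((\<lambda>t. lam t - lam s) \<longlongrightarrow> 0) (at s within {0..})"
      by (rule Lim_null_comparison[rotated])
    then show "(lam \<longlongrightarrow> lam s) (at s within {0..})" by (simp add: LIM_zero_iff)
  qed
qed

lemma lam_eq_1: "\<exists>s\<ge>0. lam s = 1"
proof -
  have ge: "lam 0 \<ge> 1" using fin ne by (simp add: lam_0 Suc_le_eq card_gt_0_iff)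
  \<comment> \<open>This choice makes the bound \<open>2 powr (- t) * lam 0\<close> equal to 1. For
    a single digit \<open>lam 0 = 1\<close>, and then the exponent with \<open>lam s = 1\<close> is
    0.\<close>
  define t where "t = log 2 (lam 0)"
  have t: "t \<ge> 0" unfolding t_def using ge by (simp add: zero_le_log_cancel_iff)
  have "lam t \<le> 2 powr (- t) * lam 0" using lam_upper[of 0 t] t by simp
  also have "\<dots> = 1" using ge by (simp add: t_def powr_minus)
  finally have "lam t \<le> 1" .
  moreover have "continuous_on {0..t} lam" by (rule continuous_on_subset[OF lam_continuous]) auto
  ultimately obtain s where "0 \<le> s" "lam s = 1" using IVT2'[of lam t 1 0] ge t by blast
  then show ?thesis by blast
qed

end

section \<open>The invariant set and its Hausdorff dimension\<close>

lemma hausdorff_content_le_finite: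
  assumes "finite I" "E \<subseteq> (\<Union>i\<in>I. V i)" "\<And>i. i \<in> I \<Longrightarrow> bounded (V i)" "\<And>i. i \<in> I \<Longrightarrow> diameter (V i) \<le> \<delta>" "\<delta> \<ge> 0"
  shows "hausdorff_content_upto d \<delta> E \<le> (\<Sum>i\<in>I. diam_power d (V i))"
proof -
  obtain h where h: "bij_betw h {0..<card I} I" using ex_bij_betw_nat_finite[OF assms(1)] by blast
  \<comment> \<open>The finite cover is padded with empty sets, which contribute 0 even for
    \<open>d = 0\<close>.\<close>
  define U where "U = (\<lambda>i. if i < card I then V (h i) else {})"
  have hI: "h i \<in> I" if "i < card I" for i using h that by (auto simp: bij_betw_def)
  have cov: "E \<subseteq> (\<Union>i. U i)"
  proof
    fix x assume "x \<in> E"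
    then obtain i where i: "i \<in> I" "x \<in> V i" using assms(2) by blast
    have "i \<in> h ` {0..<card I}" using h i by (simp add: bij_betw_def)
    then obtain k where "k < card I" "h k = i" by auto
    then show "x \<in> (\<Union>i. U i)" using i by (auto simp: U_def)
  qed
  have "hausdorff_content_upto d \<delta> E \<le> (\<Sum>i. diam_power d (U i))"
    unfolding hausdorff_content_upto_def
    by (rule INF_lower) (use cov hI assms(3-5) in \<open>auto simp: U_def\<close>)
  also have "\<dots> = (\<Sum>i\<in>{0..<card I}. diam_power d (U i))"
    by (rule suminf_finite) (auto simp: U_def diam_power_def)
  also have "\<dots> = (\<Sum>i\<in>{0..<card I}. diam_power d (V (h i)))"
    by (intro sum.cong) (auto simp: U_def)
  also have "\<dots> = (\<Sum>i\<in>I. diam_power d (V i))"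
    by (rule sum.reindex_bij_betw[OF h])
  finally show ?thesis .
qed

context digits
begin

section \<open>Existence and uniqueness of the invariant set\<close>

definition inv_set :: "real set \<Rightarrow> bool" where
  "inv_set E \<longleftrightarrow> E \<noteq> {} \<and> compact E \<and> E \<subseteq> {0..1} \<and> E = (\<Union>a\<in>A. theta a ` E)"

lemma digit_theta_unit: "a \<in> A \<Longrightarrow> x \<in> {0..1} \<Longrightarrow> theta a x \<in> {0..1}"
  using not0 by (intro theta_unit) (auto intro: gr0I)

lemma cylinders_Suc:
  "(\<Union>w\<in>words (Suc n). cf_map w ` X) = (\<Union>a\<in>A. theta a ` (\<Union>w\<in>words n. cf_map w ` X))"
proof (intro set_eqI iffI)
  fix z assume "z \<in> (\<Union>w\<in>words (Suc n). cf_map w ` X)"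
  then obtain w x where w: "w \<in> words (Suc n)" "x \<in> X" "z = cf_map w x" by blast
  then obtain a u where "w = a # u" "a \<in> A" "u \<in> words n" by (auto simp: words_Suc)
  then show "z \<in> (\<Union>a\<in>A. theta a ` (\<Union>w\<in>words n. cf_map w ` X))" using w by auto
next
  fix z assume "z \<in> (\<Union>a\<in>A. theta a ` (\<Union>w\<in>words n. cf_map w ` X))"
  then obtain a u x where u: "a \<in> A" "u \<in> words n" "x \<in> X" "z = theta a (cf_map u x)" by blast
  then have "a # u \<in> words (Suc n)" "z = cf_map (a # u) x" by (auto simp: words_Suc)
  then show "z \<in> (\<Union>w\<in>words (Suc n). cf_map w ` X)" using u(3) by blast
qed

lemma inv_set_words:
  assumes "inv_set E"
  shows "E = (\<Union>w\<in>words n. cf_map w ` E)"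
proof (induction n)
  case (Suc n)
  have "E = (\<Union>a\<in>A. theta a ` E)" using assms by (simp add: inv_set_def)
  also have "\<dots> = (\<Union>a\<in>A. theta a ` (\<Union>w\<in>words n. cf_map w ` E))" using Suc by simp
  also have "\<dots> = (\<Union>w\<in>words (Suc n). cf_map w ` E)" by (rule cylinders_Suc[symmetric])
  finally show ?case .
qed simp

text \<open>A point of \<open>E\<close> has the form \<open>cf_map w y\<close> with \<open>w\<close>
  as long as desired. Replacing \<open>y\<close> by a point of \<open>F\<close> moves it arbitrarily
  little and lands in \<open>F\<close>, which is closed. Exchanging the two sets gives
  uniqueness.\<close>

lemma inv_set_subset:
  assumes E: "inv_set E" and F: "inv_set F"
  shows "E \<subseteq> F"
proof
  fix x assume x: "x \<in> E"
  obtain f where f: "f \<in> F" using F by (auto simp: inv_set_def)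
  have sub: "E \<subseteq> {0..1}" "F \<subseteq> {0..1}" "closed F"
    using E F by (auto simp: inv_set_def compact_imp_closed)
  have "x \<in> closure F"
    unfolding closure_approachable
  proof (intro allI impI)
    fix e :: real assume "e > 0"
    then obtain k where k: "(1 / 2) ^ k < e" using real_arch_pow_inv[of e "1/2"] by auto
    obtain w y where w: "w \<in> words (2 * k)" "y \<in> E" "x = cf_map w y"
      using inv_set_words[OF E, of "2 * k"] x by blast
    have "cf_map w f \<in> F" using inv_set_words[OF F, of "2 * k"] w f by blast
    moreover have "dist (cf_map w f) x < e"
      using cf_map_close(2)[OF w(1), of f y] f w(2) sub k by (simp add: w(3) dist_real_def subset_eq)
    ultimately show "\<exists>y\<in>F. dist y x < e" by blast
  qed
  then show "x \<in> F" using sub(3) by simp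
qed

text \<open>The set is the intersection of the cylinder sets of all levels. That it lies in the
  union of its own images needs two facts: by injectivity of \<open>theta a\<close> the preimage of
  a point is the same at every level, and finiteness of \<open>A\<close> provides one level that
  serves all digits.\<close>

lemma inv_set_exists: "\<exists>E. inv_set E"
proof -
  define C where "C = (\<lambda>n. \<Union>w\<in>words n. cf_map w ` {0..1})"
  have C0: "C 0 = {0..1}" by (simp add: C_def)
  have CSuc: "C (Suc n) = (\<Union>a\<in>A. theta a ` C n)" for n unfolding C_def by (rule cylinders_Suc)
  have C01: "C n \<subseteq> {0..1}" for n
    using digit_theta_unit by (induction n) (auto simp: C0 CSuc simp del: atLeastAtMost_iff)
  have dec: "C (Suc n) \<subseteq> C n" for n
  proof (induction n)
    case 0
    show ?case using C01[of 1] by (simp add: C0)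
  next
    case (Suc n)
    show ?case using Suc unfolding CSuc[of "Suc n"] CSuc[of n] by blast
  qed
  then have anti: "m \<le> n \<Longrightarrow> C n \<subseteq> C m" for m n by (rule lift_Suc_antimono_le[of C])
  have comp: "compact (C n)" for n
  proof (induction n)
    case (Suc n)
    have "continuous_on (C n) (theta a)" if "a \<in> A" for a
      unfolding theta_def using C01[of n] digit_ge_1[OF that] by (intro continuous_intros) fastforce
    then show ?case unfolding CSuc using Suc by (intro compact_UN fin compact_continuous_image) auto
  qed (simp add: C0)
  have Cne: "C n \<noteq> {}" for n by (induction n) (use ne in \<open>auto simp: C0 CSuc\<close>)
  define E where "E = (\<Inter>n. C n)"
  have "E \<noteq> {}" unfolding E_def using compact_nest[of C] comp Cne anti by blast
  moreover have "compact E" unfolding E_def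
    using comp by (intro compact_Inter) auto
  moreover have "E \<subseteq> {0..1}" unfolding E_def using C0 by blast
  moreover have "E = (\<Union>a\<in>A. theta a ` E)"
  proof
    show "(\<Union>a\<in>A. theta a ` E) \<subseteq> E"
    proof clarify
      fix a x assume a: "a \<in> A" "x \<in> E"
      have "theta a x \<in> C n" for n
      proof -
        have "theta a x \<in> C (Suc n)" using a by (auto simp: E_def CSuc)
        then show ?thesis using dec by blast
      qed
      then show "theta a x \<in> E" by (simp add: E_def)
    qed
    show "E \<subseteq> (\<Union>a\<in>A. theta a ` E)"
    proof (rule ccontr)
      assume "\<not> ?thesis"
      then obtain y where y: "y \<in> E" "\<And>a. a \<in> A \<Longrightarrow> y \<notin> theta a ` E" by blast
      have "\<exists>n. y \<notin> theta a ` C n" if a: "a \<in> A" for a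
      proof (rule ccontr)
        assume "\<not> ?thesis"
        then have all: "y \<in> theta a ` C n" for n by blast
        then obtain x where x: "x \<in> C 0" "y = theta a x" by blast
        have "x \<in> C n" for n
        proof -
          obtain x' where x': "x' \<in> C n" "y = theta a x'" using all by blast
          have "x = x'"
            using x x' C01[of n] C01[of 0] digit_ge_1[OF a] by (intro theta_inj[of x x' a]) auto
          then show ?thesis using x' by simp
        qed
        then show False using y(2)[OF a] x(2) by (auto simp: E_def)
      qed
      then obtain f where f: "\<And>a. a \<in> A \<Longrightarrow> y \<notin> theta a ` C (f a)" by metis
      have "f a \<le> Max (f ` A)" if "a \<in> A" for a using that fin by simp
      then have "y \<notin> theta a ` C (Max (f ` A))" if "a \<in> A" for a
        using f[OF that] anti that by blast
      then have "y \<notin> C (Suc (Max (f ` A)))" by (auto simp: CSuc)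
      then show False using y(1) by (auto simp: E_def)
    qed
  qed
  ultimately show ?thesis unfolding inv_set_def by blast
qed

lemma inv_set_ex1: "\<exists>!E. inv_set E"
  using inv_set_exists inv_set_subset by blast

section \<open>Upper bound for the Hausdorff dimension\<close>

lemma hausdorff_measure_eq_0:
  assumes E: "inv_set E" and d: "d > 0" "lam d < 1"
  shows "hausdorff_measure d E = 0"
proof -
  have E01: "E \<subseteq> {0..1}" "E \<noteq> {}" using E by (auto simp: inv_set_def)
  have "hausdorff_content_upto d \<delta> E = 0" if "\<delta> > 0" for \<delta>
  proof -
    have "hausdorff_content_upto d \<delta> E \<le> ennreal e" if "e > 0" for e
    proof -
      obtain k where k: "(1 / 2) ^ k < \<delta>" using real_arch_pow_inv[OF \<open>\<delta> > 0\<close>, of "1/2"] by auto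
      have lp: "lam d > 0" using lam_pos d by simp
      have "e / 4 powr d > 0" using that by simp
      then obtain j where j: "lam d ^ j < e / 4 powr d" using real_arch_pow_inv d(2) by blast
      \<comment> \<open>The part \<open>2 * k\<close> of the length makes the cylinders smaller than
        \<open>\<delta>\<close>, the part \<open>j\<close> makes the total weight smaller than
        \<open>e\<close>.\<close>
      define n where "n = 2 * k + j"
      have nk: "k \<le> n div 2" by (simp add: n_def)
      have "lam d ^ n \<le> lam d ^ j" using d lp by (intro power_decreasing) (auto simp: n_def)
      then have "4 powr d * lam d ^ n \<le> 4 powr d * (e / 4 powr d)" using j by (intro mult_left_mono) auto
      then have pe: "psum d n \<le> e" using lam_psum(2)[of d n] d by simp
      have bdd: "bounded (cf_map w ` E)" and diam: "diameter (cf_map w ` E) \<le> 1 / (cf_den w 0)\<^sup>2"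
          "diameter (cf_map w ` E) \<le> \<delta>" if w: "w \<in> words n" for w
      proof -
        have sub: "cf_map w ` E \<subseteq> {0..1}"
          using E01 cf_map_unit[OF words_not0[OF w]] by blast
        show "bounded (cf_map w ` E)" using bounded_subset[OF _ sub] by simp
        have close: "norm (x - y) \<le> 1 / (cf_den w 0)\<^sup>2" "norm (x - y) \<le> (1 / 2) ^ (n div 2)"
          if im: "x \<in> cf_map w ` E" "y \<in> cf_map w ` E" for x y
        proof -
          obtain x' y' where "x' \<in> E" "y' \<in> E" and xy: "x = cf_map w x'" "y = cf_map w y'" using im by blast
          then have u: "x' \<in> {0..1}" "y' \<in> {0..1}" using E01 by auto
          show "norm (x - y) \<le> 1 / (cf_den w 0)\<^sup>2" "norm (x - y) \<le> (1 / 2) ^ (n div 2)"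
            using cf_map_close[OF w u] by (simp_all only: xy real_norm_def)
        qed
        show "diameter (cf_map w ` E) \<le> 1 / (cf_den w 0)\<^sup>2"
          using E01 close by (intro diameter_le) auto
        have "diameter (cf_map w ` E) \<le> (1 / 2) ^ (n div 2)"
          using E01 close by (intro diameter_le) auto
        also have "\<dots> \<le> (1 / 2) ^ k" using nk by (intro power_decreasing) auto
        finally show "diameter (cf_map w ` E) \<le> \<delta>" using k by simp
      qed
      have "hausdorff_content_upto d \<delta> E \<le> (\<Sum>w\<in>words n. diam_power d (cf_map w ` E))"
        using inv_set_words[OF E, of n] bdd diam \<open>\<delta> > 0\<close>
        by (intro hausdorff_content_le_finite finite_words) auto
      also have "\<dots> \<le> (\<Sum>w\<in>words n. ennreal (cf_den w 0 powr (- 2 * d)))"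
      proof (rule sum_mono)
        fix w assume w: "w \<in> words n"
        have q: "cf_den w 0 > 0" using cf_den_pos[OF words_not0[OF w]] by simp
        have "diameter (cf_map w ` E) powr d \<le> (1 / (cf_den w 0)\<^sup>2) powr d"
          using diam(1)[OF w] diameter_ge_0[OF bdd[OF w]] d by (intro powr_mono2) auto
        also have "1 / (cf_den w 0)\<^sup>2 = cf_den w 0 powr (- 2)"
          using q by (simp add: powr_minus powr_numeral field_simps)
        finally show "diam_power d (cf_map w ` E) \<le> ennreal (cf_den w 0 powr (- 2 * d))"
          using E01 d by (simp add: diam_power_def powr_powr ennreal_leI)
      qed
      also have "\<dots> = ennreal (psum d n)" unfolding psum_def by (rule sum_ennreal) simp
      also have "\<dots> \<le> ennreal e" using pe by (rule ennreal_leI)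
      finally show ?thesis .
    qed
    then have le: "hausdorff_content_upto d \<delta> E \<le> 0 + ennreal e" if "e > 0" for e using that by simp
    have "hausdorff_content_upto d \<delta> E \<le> 0" by (rule ennreal_le_epsilon, rule le)
    then show ?thesis by simp
  qed
  then show ?thesis unfolding hausdorff_measure_def by simp
qed

text \<open>
  For the digit 1 the images of the unit interval under neighbouring maps share an end point. Points
  of the invariant set stay away from 1, which separates the images of the invariant set.
\<close>

definition gap :: real where
  "gap = 1 / (real (Max A) + 2) / (real (Max A) + 1)\<^sup>2"

lemma gap_pos: "gap > 0" unfolding gap_def by (intro divide_pos_pos) (auto simp: add_pos_nonneg add_nonneg_pos)

text \<open>Write G for \<open>Max A\<close>. Points of \<open>E\<close> are at least 1/(G+1), and
  therefore, being images of such points, at most 1 - 1/(G+2). For \<open>a < b\<close> the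
  difference of the images has numerator at least \<open>1 - x\<close>, which is at least 1/(G+2),
  and denominator at most the square of G+1. This is the origin of both factors of
  \<open>gap\<close>.\<close>

lemma inv_set_gap:
  assumes E: "inv_set E" and x: "x \<in> E" "y \<in> E" and ab: "a \<in> A" "b \<in> A" "a \<noteq> b"
  shows "gap \<le> \<bar>theta a x - theta b y\<bar>"
proof -
  let ?G = "real (Max A)"
  have E01: "E \<subseteq> {0..1}" using E by (auto simp: inv_set_def)
  have ge: "1 / (?G + 1) \<le> z" if z: "z \<in> E" for z
  proof -
    obtain c u where c: "c \<in> A" "u \<in> E" "z = theta c u" using E z unfolding inv_set_def by blast
    have "real c \<le> ?G" "real c \<ge> 1" "u \<in> {0..1}" using c fin digit_ge_1 E01 by auto
    then show ?thesis unfolding c(3) theta_def by (intro divide_left_mono) (auto intro!: mult_pos_pos)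
  qed
  have le: "z \<le> 1 - 1 / (?G + 2)" if z: "z \<in> E" for z
  proof -
    obtain c u where c: "c \<in> A" "u \<in> E" "z = theta c u" using E z unfolding inv_set_def by blast
    have "1 / (?G + 1) \<le> u" "real c \<ge> 1" using ge c digit_ge_1 by auto
    moreover have "0 < u"
      by (rule less_le_trans[of 0 "1 / (?G + 1)"]) (use calculation in \<open>simp_all add: add_nonneg_pos\<close>)
    ultimately have "z \<le> 1 / (1 / (?G + 1) + 1)"
      unfolding c(3) theta_def by (intro divide_left_mono mult_pos_pos) (auto simp: add_pos_pos add_nonneg_pos)
    also have "1 / (1 / (?G + 1) + 1) = 1 - 1 / (?G + 2)" by (simp add: field_simps)
    finally show ?thesis .
  qed
  have main: "gap \<le> \<bar>theta a x - theta b y\<bar>" if "a < b" "a \<in> A" "b \<in> A" "x \<in> E" "y \<in> E" for a b x y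
  proof -
    have x: "0 \<le> x" "x \<le> 1 - 1 / (?G + 2)" "x \<le> 1" and y: "0 \<le> y" "y \<le> 1" using that E01 le by auto
    have a: "1 \<le> real a" "real a \<le> ?G" "real b \<le> ?G" "real a + 1 \<le> real b"
      using that digit_ge_1 fin by auto
    have "gap \<le> (y + real b - (x + real a)) / ((x + real a) * (y + real b))"
      unfolding gap_def
    proof (rule frac_le)
      show "1 / (?G + 2) \<le> y + real b - (x + real a)" using x y a by linarith
      show "0 \<le> y + real b - (x + real a)" using x y a by linarith
      show "0 < (x + real a) * (y + real b)" using x y a by (intro mult_pos_pos) auto
      show "(x + real a) * (y + real b) \<le> (?G + 1)\<^sup>2"
        unfolding power2_eq_square using x y a by (intro mult_mono) auto
    qed
    also have "\<dots> = theta a x - theta b y"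
    proof -
      have "x + real a > 0" "y + real b > 0" using x y a by auto
      then show ?thesis by (simp add: theta_def field_simps)
    qed
    finally show ?thesis by simp
  qed
  show ?thesis
  proof (cases "a < b")
    case True
    then show ?thesis using main x ab by blast
  next
    case False
    then have "b < a" using ab by simp
    then show ?thesis using main[of b a y x] x ab by (simp add: abs_minus_commute)
  qed
qed

section \<open>Coding of points by words and the lower bound for the dimension\<close>

lemma inv_set_prefix:
  assumes E: "inv_set E"
  shows "set w \<subseteq> A \<Longrightarrow> set u \<subseteq> A \<Longrightarrow> length w \<le> length u \<Longrightarrow> x \<in> E \<Longrightarrow> y \<in> E \<Longrightarrow>
    cf_map u x = cf_map w y \<Longrightarrow> take (length w) u = w"
proof (induction w arbitrary: u)
  case (Cons b w)
  then obtain a u' where u: "u = a # u'" by (cases u) auto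
  have inE: "cf_map v z \<in> E" if "set v \<subseteq> A" "z \<in> E" for v z
    using inv_set_words[OF E, of "length v"] that by (auto simp: words_def)
  have i: "cf_map u' x \<in> E" "cf_map w y \<in> E" using Cons.prems u inE by auto
  have eq: "theta a (cf_map u' x) = theta b (cf_map w y)" using Cons.prems(6) u by simp
  \<comment> \<open>Different first letters would put a positive gap between two equal
    points.\<close>
  have "a = b"
    using inv_set_gap[OF E i, of a b] gap_pos eq Cons.prems u by fastforce
  moreover have "cf_map u' x = cf_map w y"
  proof (rule theta_inj[of _ _ b])
    show "cf_map u' x \<ge> 0" "cf_map w y \<ge> 0" using i E by (auto simp: inv_set_def)
    show "b > 0" using Cons.prems not0 by (auto intro: gr0I)
    show "theta b (cf_map u' x) = theta b (cf_map w y)" using eq \<open>a = b\<close> by simp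
  qed
  ultimately show ?case using Cons.IH[of u'] Cons.prems u by simp
qed simp

text \<open>The other cylinders of the same level form a finite union of compact sets, disjoint from
  this one by uniqueness of the coding. Relative openness lets compactness of \<open>E\<close>
  extract a finite subcover from cylinders.\<close>

lemma cylinder_open:
  assumes E: "inv_set E" and w: "set w \<subseteq> A"
  shows "\<exists>T. open T \<and> cf_map w ` E = E \<inter> T"
proof -
  let ?n = "length w"
  have ww: "w \<in> words ?n" using w by (simp add: words_def)
  define D where "D = (\<Union>u\<in>words ?n - {w}. cf_map u ` E)"
  have cE: "compact E" "E \<subseteq> {0..1}" using E by (auto simp: inv_set_def)
  have cont: "continuous_on E (cf_map u)" if "u \<in> words n" for u n
    unfolding continuous_on_iff
  proof (intro ballI allI impI)
    fix x e :: real assume x: "x \<in> E" and e: "e > 0"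
    have u0: "0 \<notin> set u" by (rule words_not0[OF that])
    have "dist (cf_map u y) (cf_map u x) < e" if y: "y \<in> E" "dist y x < e" for y
    proof -
      have xy: "x \<ge> 0" "y \<ge> 0" using x y cE by auto
      have "1 * 1 \<le> cf_den u y * cf_den u x"
        using cf_den_ge_1[OF u0 xy(1)] cf_den_ge_1[OF u0 xy(2)] by (intro mult_mono) auto
      then have "\<bar>y - x\<bar> / (cf_den u y * cf_den u x) \<le> \<bar>y - x\<bar> / 1" by (intro frac_le) auto
      then show ?thesis using cf_map_diff[OF u0 xy(2) xy(1)] y by (simp add: dist_real_def)
    qed
    then show "\<exists>d>0. \<forall>x'\<in>E. dist x' x < d \<longrightarrow> dist (cf_map u x') (cf_map u x) < e" using e by blast
  qed
  have "compact D" unfolding D_def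
    using cE cont by (intro compact_UN compact_continuous_image) (auto simp: finite_words)
  then have "open (- D)" by (simp add: compact_imp_closed open_Compl)
  moreover have "cf_map w ` E = E \<inter> - D"
  proof
    show "cf_map w ` E \<subseteq> E \<inter> - D"
    proof
      fix z assume z: "z \<in> cf_map w ` E"
      have "z \<notin> D"
      proof
        assume "z \<in> D"
        then obtain u x where u: "u \<in> words ?n" "u \<noteq> w" "x \<in> E" "z = cf_map u x" by (auto simp: D_def)
        obtain y where "y \<in> E" "z = cf_map w y" using z by blast
        then have "take ?n u = w"
          using u w by (intro inv_set_prefix[OF E, of w u x y]) (auto simp: words_def)
        then show False using u by (simp add: words_def)
      qed
      moreover have "z \<in> E" using inv_set_words[OF E, of ?n] ww z by blast
      ultimately show "z \<in> E \<inter> - D" by blast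
    qed
    show "E \<inter> - D \<subseteq> cf_map w ` E"
      using inv_set_words[OF E, of ?n] unfolding D_def by blast
  qed
  ultimately show ?thesis by blast
qed

text \<open>
  The word is the longest common prefix of the points of \<open>U \<inter> E\<close>. The error \<open>e\<close> is only needed if
  \<open>U \<inter> E\<close> is a single point, which has no longest prefix.
\<close>

lemma cylinder_cover:
  assumes E: "inv_set E" and U: "bounded U" "U \<inter> E \<noteq> {}" and s: "s > 0" and e: "e > 0"
  shows "\<exists>w. set w \<subseteq> A \<and> U \<inter> E \<subseteq> cf_map w ` E \<and>
    cf_den w 0 powr (- 2 * s) \<le> (4 / gap) powr s * diameter U powr s + e"
proof (cases "\<forall>n. \<exists>w\<in>words n. U \<inter> E \<subseteq> cf_map w ` E")
  case True
  have "(2::real) powr (- 2 * s) < 2 powr 0" using s by (intro powr_less_mono) auto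
  then have "(2::real) powr (- 2 * s) < 1" by simp
  then obtain k where k: "(2 powr (- 2 * s)) ^ k < e" using real_arch_pow_inv[OF e] by blast
  obtain w where w: "w \<in> words (2 * k)" "U \<inter> E \<subseteq> cf_map w ` E" using True by blast
  have g: "2 ^ k \<le> cf_den w 0"
    using cf_den_growth[OF words_not0[OF w(1)], of 0] length_words[OF w(1)] by simp
  then have "cf_den w 0 powr (- 2 * s) \<le> (2 ^ k) powr (- 2 * s)" using s by (intro powr_mono2') auto
  also have "\<dots> = (2 powr (- 2 * s)) ^ k"
    by (simp add: powr_realpow[symmetric] powr_powr mult.commute)
  also have "\<dots> \<le> (4 / gap) powr s * diameter U powr s + e" using k by (simp add: add_increasing)
  finally show ?thesis using w by (intro exI[of _ w]) (auto simp: words_def)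
next
  case False
  \<comment> \<open>The first level at which no single cylinder contains
    \<open>U \<inter> E\<close>. It is positive, since the empty word gives all of
    \<open>E\<close>.\<close>
  define n where "n = (LEAST n. \<not> (\<exists>w\<in>words n. U \<inter> E \<subseteq> cf_map w ` E))"
  have n: "\<not> (\<exists>w\<in>words n. U \<inter> E \<subseteq> cf_map w ` E)"
    unfolding n_def using False by (intro LeastI_ex[of "\<lambda>n. \<not> (\<exists>w\<in>words n. U \<inter> E \<subseteq> cf_map w ` E)"]) blast
  have "n \<noteq> 0"
  proof
    assume "n = 0"
    then show False using n by simp
  qed
  then obtain p where p: "n = Suc p" by (cases n) auto
  have "\<exists>w\<in>words p. U \<inter> E \<subseteq> cf_map w ` E"
    using not_less_Least[of p "\<lambda>n. \<not> (\<exists>w\<in>words n. U \<inter> E \<subseteq> cf_map w ` E)"] unfolding n_def[symmetric] p by blast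
  then obtain w where w: "w \<in> words p" "U \<inter> E \<subseteq> cf_map w ` E" by blast
  have w0: "0 \<notin> set w" by (rule words_not0[OF w(1)])
  obtain x where x: "x \<in> U \<inter> E" using U by blast
  then obtain e1 where e1: "e1 \<in> E" "x = cf_map w e1" using w by blast
  then obtain a f1 where f1: "a \<in> A" "f1 \<in> E" "e1 = theta a f1" using E unfolding inv_set_def by blast
  \<comment> \<open>After \<open>w\<close> the point \<open>x\<close> continues with the letter
    \<open>a\<close>. By the choice of \<open>n\<close> some \<open>y\<close> in
    \<open>U \<inter> E\<close> continues with a different letter \<open>b\<close>, so
    \<open>gap\<close> applies one level below \<open>w\<close>.\<close>
  have "w @ [a] \<in> words n" using w f1 p by (auto simp: words_def)
  then obtain y where y: "y \<in> U \<inter> E" "y \<notin> cf_map (w @ [a]) ` E" using n by blast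
  then obtain e2 where e2: "e2 \<in> E" "y = cf_map w e2" using w by blast
  then obtain b f2 where f2: "b \<in> A" "f2 \<in> E" "e2 = theta b f2" using E unfolding inv_set_def by blast
  have "a \<noteq> b" using y e2 f2 by (auto simp: cf_map_append)
  then have g: "gap \<le> \<bar>e1 - e2\<bar>" unfolding f1 f2 using f1 f2 by (intro inv_set_gap[OF E]) auto
  have unit: "e1 \<in> {0..1}" "e2 \<in> {0..1}" using e1 e2 E by (auto simp: inv_set_def)
  have q: "cf_den w 0 > 0" using cf_den_pos[OF w0] by simp
  \<comment> \<open>Each of the two denominators is at most twice its value at 0; this is the source
    of the factor 4.\<close>
  have d: "cf_den w e1 * cf_den w e2 \<le> (2 * cf_den w 0) * (2 * cf_den w 0)"
    "cf_den w e1 > 0" "cf_den w e2 > 0"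
  proof -
    show p: "cf_den w e1 > 0" "cf_den w e2 > 0" using cf_den_pos[OF w0] unit by auto
    show "cf_den w e1 * cf_den w e2 \<le> (2 * cf_den w 0) * (2 * cf_den w 0)"
      using cf_den_le(2)[OF w0 unit(1)] cf_den_le(2)[OF w0 unit(2)] p q by (intro mult_mono) auto
  qed
  have "gap / ((2 * cf_den w 0) * (2 * cf_den w 0)) \<le> \<bar>e1 - e2\<bar> / (cf_den w e1 * cf_den w e2)"
    using g d by (intro frac_le) auto
  also have "\<dots> = dist x y"
    unfolding e1(2) e2(2) dist_real_def using unit by (intro cf_map_diff[OF w0, symmetric]) auto
  also have "\<dots> \<le> diameter U" using x y U by (intro diameter_bounded_bound) auto
  finally have "1 / (cf_den w 0)\<^sup>2 \<le> 4 / gap * diameter U"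
    using gap_pos q by (simp add: field_simps power2_eq_square)
  moreover have "1 / (cf_den w 0)\<^sup>2 = cf_den w 0 powr (- 2)"
    using q by (simp add: powr_minus powr_numeral field_simps)
  ultimately have "(cf_den w 0 powr (- 2)) powr s \<le> (4 / gap * diameter U) powr s"
    using s by (intro powr_mono2) auto
  then have "cf_den w 0 powr (- 2 * s) \<le> (4 / gap) powr s * diameter U powr s"
    by (simp only: powr_powr powr_mult)
  then show ?thesis using w e by (intro exI[of _ w]) (auto simp: words_def)
qed

text \<open>This replaces the mass distribution principle. When \<open>lam s = 1\<close>, all sums
  \<open>psum s n\<close> lie between 1 and \<open>4 powr s\<close>. Since the cylinders cover
  \<open>E\<close>, every word of the large length \<open>n\<close> extends some \<open>w i\<close>,
  and all extensions of \<open>w i\<close> together weigh at most \<open>4 powr s\<close> times the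
  weight of \<open>w i\<close>.\<close>

lemma cylinder_cover_weight:
  assumes E: "inv_set E" and s: "s \<ge> 0" "lam s = 1" and I: "finite I"
    and w: "\<And>i. i \<in> I \<Longrightarrow> set (w i) \<subseteq> A" and cov: "E \<subseteq> (\<Union>i\<in>I. cf_map (w i) ` E)"
  shows "1 \<le> 4 powr s * (\<Sum>i\<in>I. cf_den (w i) 0 powr (- 2 * s))"
proof -
  \<comment> \<open>A convenient common upper bound for the lengths of the words.\<close>
  define n where "n = (\<Sum>i\<in>I. length (w i))"
  have len: "length (w i) \<le> n" if "i \<in> I" for i
    unfolding n_def using that I by (intro member_le_sum) auto
  define f where "f = (\<lambda>u. cf_den u 0 powr (- 2 * s))"
  obtain e where e: "e \<in> E" using E by (auto simp: inv_set_def)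
  have "1 \<le> psum s n" using lam_psum(1)[OF s(1), of n] s(2) by simp
  also have "\<dots> \<le> (\<Sum>u\<in>words n. \<Sum>i\<in>I. if take (length (w i)) u = w i then f u else 0)"
    unfolding psum_def
  proof (rule sum_mono)
    fix u assume u: "u \<in> words n"
    have "cf_map u e \<in> E" using inv_set_words[OF E, of n] u e by blast
    then obtain i y where i: "i \<in> I" "y \<in> E" "cf_map u e = cf_map (w i) y" using cov by blast
    have "take (length (w i)) u = w i"
      using i u len[OF i(1)] w[OF i(1)] e by (intro inv_set_prefix[OF E, of "w i" u e y]) (auto simp: words_def)
    then have "cf_den u 0 powr (- 2 * s) = (if take (length (w i)) u = w i then f u else 0)" by (simp add: f_def)
    also have "\<dots> \<le> (\<Sum>i\<in>I. if take (length (w i)) u = w i then f u else 0)"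
      using i I by (intro member_le_sum) (auto simp: f_def)
    finally show "cf_den u 0 powr (- 2 * s) \<le> (\<Sum>i\<in>I. if take (length (w i)) u = w i then f u else 0)" .
  qed
  also have "\<dots> = (\<Sum>i\<in>I. \<Sum>u\<in>words n. if take (length (w i)) u = w i then f u else 0)"
    by (rule sum.swap)
  also have "\<dots> \<le> (\<Sum>i\<in>I. 4 powr s * f (w i))"
  proof (rule sum_mono)
    fix i assume i: "i \<in> I"
    define l where "l = length (w i)"
    obtain k where k: "n = l + k" using len[OF i] unfolding l_def by (metis le_add_diff_inverse)
    have wi: "w i \<in> words l" using w[OF i] by (simp add: words_def l_def)
    have "(\<Sum>u\<in>words n. if take (length (w i)) u = w i then f u else 0)
        = (\<Sum>v\<in>words k. \<Sum>u\<in>words l. if take l (u @ v) = w i then f (u @ v) else 0)"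
      unfolding k sum_words_add l_def by simp
    also have "\<dots> = (\<Sum>v\<in>words k. \<Sum>u\<in>words l. if u = w i then f (u @ v) else 0)"
      by (intro sum.cong refl) (auto simp: words_def)
    also have "\<dots> = (\<Sum>v\<in>words k. f (w i @ v))"
      using wi by (simp add: sum.delta finite_words)
    also have "\<dots> \<le> (\<Sum>v\<in>words k. f (w i) * cf_den v 0 powr (- 2 * s))"
    proof (rule sum_mono)
      fix v assume v: "v \<in> words k"
      have "cf_map v 0 \<in> {0..1}" using cf_map_unit[OF words_not0[OF v], of 0] by simp
      note c = cf_den_le(1)[OF words_not0[OF wi] this]
      have p: "cf_den v 0 > 0" "cf_den (w i) 0 > 0"
        using cf_den_pos[OF words_not0[OF v]] cf_den_pos[OF words_not0[OF wi]] by auto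
      have "f (w i @ v) \<le> (cf_den v 0 * cf_den (w i) 0) powr (- 2 * s)"
        unfolding f_def cf_den_append using c p s by (intro powr_mono2' mult_left_mono) auto
      also have "\<dots> = f (w i) * cf_den v 0 powr (- 2 * s)"
        unfolding f_def by (subst powr_mult) (rule mult.commute)
      finally show "f (w i @ v) \<le> f (w i) * cf_den v 0 powr (- 2 * s)" .
    qed
    also have "\<dots> = f (w i) * psum s k" by (simp only: psum_def sum_distrib_left)
    also have "\<dots> \<le> f (w i) * 4 powr s"
      using lam_psum(2)[OF s(1), of k] s(2) by (intro mult_left_mono) (auto simp: f_def)
    finally show "(\<Sum>u\<in>words n. if take (length (w i)) u = w i then f u else 0) \<le> 4 powr s * f (w i)"
      by (simp add: mult.commute)
  qed
  finally show ?thesis by (simp add: sum_distrib_left f_def)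
qed

text \<open>Passes from the exponent \<open>d\<close> of the cover to the larger exponent
  \<open>s\<close>, at which word sums are controlled. For \<open>d = 0\<close> the right-hand side
  is 1 by convention.\<close>

lemma diameter_powr_le_diam_power:
  assumes "0 \<le> d" "d \<le> s" "bounded U" "U \<noteq> {}" "diameter U \<le> 1"
  shows "ennreal (diameter U powr s) \<le> diam_power d U"
proof -
  have D: "0 \<le> diameter U" using assms by (intro diameter_ge_0)
  show ?thesis
  proof (cases "d = 0")
    case True
    have "diameter U powr s \<le> 1"
      using D assms powr_le1[of s "diameter U"] by simp
    then show ?thesis using True assms by (simp add: diam_power_def)
  next
    case False
    have "diameter U powr s \<le> diameter U powr d"
      using D assms by (intro powr_mono') auto
    then show ?thesis using False assms by (simp add: diam_power_def ennreal_leI)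
  qed
qed

lemma hausdorff_measure_pos:
  assumes E: "inv_set E" and d: "0 \<le> d" "d < s" and s: "lam s = 1"
  shows "hausdorff_measure d E \<noteq> 0"
proof
  assume z: "hausdorff_measure d E = 0"
  define C where "C = 4 powr s * (4 / gap) powr s"
  have C: "C > 0" unfolding C_def using gap_pos by simp
  have s0: "s > 0" using d by simp
  have "hausdorff_content_upto d 1 E \<le> hausdorff_measure d E"
    unfolding hausdorff_measure_def by (rule SUP_upper) simp
  \<comment> \<open>Scale 1 suffices and ensures diameters at most 1. The cover is allowed to
    contribute 1/4 after multiplication by \<open>C\<close>.\<close>
  then have "hausdorff_content_upto d 1 E < ennreal (1 / (4 * C))" using z C by simp
  then obtain U where cov: "E \<subseteq> (\<Union>i. U i)" and U: "\<And>i. bounded (U i)" "\<And>i. diameter (U i) \<le> 1"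
    and sumU: "(\<Sum>i. diam_power d (U i)) < ennreal (1 / (4 * C))"
    unfolding hausdorff_content_upto_def INF_less_iff by auto
  \<comment> \<open>The errors from single-point pieces are spread geometrically as
    \<open>e * (1 / 2) ^ Suc i\<close> and contribute at most another 1/4, so the total stays below
    1.\<close>
  define e where "e = 1 / (4 * 4 powr s)"
  have e: "e > 0" unfolding e_def by simp
  define I0 where "I0 = {i. U i \<inter> E \<noteq> {}}"
  have "\<forall>i\<in>I0. \<exists>w. set w \<subseteq> A \<and> U i \<inter> E \<subseteq> cf_map w ` E \<and>
    cf_den w 0 powr (- 2 * s) \<le> (4 / gap) powr s * diameter (U i) powr s + e * (1 / 2) ^ Suc i"
    using cylinder_cover[OF E U(1) _ s0] e unfolding I0_def by simp
  then obtain w where w: "\<And>i. i \<in> I0 \<Longrightarrow> set (w i) \<subseteq> A" "\<And>i. i \<in> I0 \<Longrightarrow> U i \<inter> E \<subseteq> cf_map (w i) ` E"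
    "\<And>i. i \<in> I0 \<Longrightarrow> cf_den (w i) 0 powr (- 2 * s) \<le> (4 / gap) powr s * diameter (U i) powr s + e * (1 / 2) ^ Suc i"
    by metis
  obtain W where W: "\<And>i. i \<in> I0 \<Longrightarrow> open (W i)" "\<And>i. i \<in> I0 \<Longrightarrow> cf_map (w i) ` E = E \<inter> W i"
    using cylinder_open[OF E w(1)] by metis
  have "E \<subseteq> (\<Union>i\<in>I0. W i)"
  proof
    fix x assume x: "x \<in> E"
    then obtain i where "x \<in> U i" using cov by blast
    then have "i \<in> I0" "x \<in> cf_map (w i) ` E" using x w(2)[of i] by (auto simp: I0_def)
    then show "x \<in> (\<Union>i\<in>I0. W i)" using W(2) by blast
  qed
  moreover have "compact E" using E by (simp add: inv_set_def)
  ultimately obtain I where I: "I \<subseteq> I0" "finite I" "E \<subseteq> (\<Union>i\<in>I. W i)"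
    using W(1) by (elim compactE_image) auto
  have "E \<subseteq> (\<Union>i\<in>I. cf_map (w i) ` E)" using I W(2) by blast
  then have "1 \<le> 4 powr s * (\<Sum>i\<in>I. cf_den (w i) 0 powr (- 2 * s))"
    using cylinder_cover_weight[OF E _ s I(2), of w] w(1) I(1) s0 by auto
  also have "\<dots> \<le> 4 powr s * (\<Sum>i\<in>I. (4 / gap) powr s * diameter (U i) powr s + e * (1 / 2) ^ Suc i)"
    using w(3) I(1) by (intro mult_left_mono sum_mono) auto
  also have "\<dots> = C * (\<Sum>i\<in>I. diameter (U i) powr s) + 4 powr s * e * (\<Sum>i\<in>I. (1 / 2) ^ Suc i)"
    by (simp only: sum.distrib sum_distrib_left[symmetric] C_def distrib_left mult.assoc)
  also have "\<dots> \<le> C * (1 / (4 * C)) + 4 powr s * e * 1"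
  proof (intro add_mono mult_left_mono)
    have "ennreal (\<Sum>i\<in>I. diameter (U i) powr s) = (\<Sum>i\<in>I. ennreal (diameter (U i) powr s))"
      by (rule sum_ennreal[symmetric]) simp
    also have "\<dots> \<le> (\<Sum>i\<in>I. diam_power d (U i))"
      using I(1) U d by (intro sum_mono diameter_powr_le_diam_power) (auto simp: I0_def)
    also have "\<dots> \<le> (\<Sum>i. diam_power d (U i))"
      using I(2) by (intro sum_le_suminf) auto
    finally have "ennreal (\<Sum>i\<in>I. diameter (U i) powr s) < ennreal (1 / (4 * C))" using sumU by simp
    then show "(\<Sum>i\<in>I. diameter (U i) powr s) \<le> 1 / (4 * C)"
      using C by (subst (asm) ennreal_less_iff) (auto simp: sum_nonneg)
    have "(\<Sum>i\<in>I. (1 / 2 :: real) ^ Suc i) \<le> (\<Sum>i. (1 / 2) ^ Suc i)"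
      using I(2) power_half_series by (intro sum_le_suminf) (auto simp: sums_iff)
    then show "(\<Sum>i\<in>I. (1 / 2 :: real) ^ Suc i) \<le> 1" using power_half_series by (simp add: sums_iff)
  qed (use C e in auto)
  also have "\<dots> = 1 / 2" using C by (simp add: e_def)
  finally show False by simp
qed

text \<open>Strict monotonicity gives \<open>lam (s + e) < 1\<close> and hence measure zero at
  \<open>s + e\<close> for every \<open>e > 0\<close>; the upper bound at \<open>s\<close> results
  from letting \<open>e\<close> tend to 0.\<close>

lemma hausdorff_dim_inv_set:
  assumes E: "inv_set E" and s: "s \<ge> 0" "lam s = 1"
  shows "hausdorff_dim E = ennreal s"
proof (rule antisym)
  have le: "hausdorff_dim E \<le> ennreal s + ennreal e" if "e > 0" for e
  proof -
    have "lam (s + e) < 1" using lam_strict[of s "s + e"] s that by simp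
    then have "hausdorff_measure (s + e) E = 0" using s that by (intro hausdorff_measure_eq_0[OF E]) auto
    then have "hausdorff_dim E \<le> ennreal (s + e)"
      unfolding hausdorff_dim_def using s that by (intro INF_lower) auto
    then show ?thesis using s that by (simp add: ennreal_plus)
  qed
  show "hausdorff_dim E \<le> ennreal s" by (rule ennreal_le_epsilon, rule le)
  show "ennreal s \<le> hausdorff_dim E"
    unfolding hausdorff_dim_def
  proof (rule INF_greatest)
    fix d assume "d \<in> {d. 0 \<le> d \<and> hausdorff_measure d E = 0}"
    then have "s \<le> d" using hausdorff_measure_pos[OF E, of d s] s by force
    then show "ennreal s \<le> ennreal d" by (rule ennreal_leI)
  qed
qed

end

text \<open>Derivatives within the interval see only values on it, so agreement there carries the
  induction. Nondegeneracy \<open>a < b\<close> makes the one-sided derivatives at the end points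
  unique.\<close>

lemma iter_deriv_on_interval:
  fixes F :: "nat \<Rightarrow> real \<Rightarrow> real"
  assumes "a < b" and v: "\<And>x. x \<in> {a..b} \<Longrightarrow> v x = F 0 x"
    and F: "\<And>p x. x \<in> {a..b} \<Longrightarrow> (F p has_real_derivative F (Suc p) x) (at x within {a..b})"
  shows "x \<in> {a..b} \<Longrightarrow> iter_deriv_on {a..b} p v x = F p x"
proof (induction p arbitrary: x)
  case (Suc p)
  have "(iter_deriv_on {a..b} p v has_vector_derivative F (Suc p) x) (at x within {a..b})"
    by (rule has_vector_derivative_transform[OF Suc.prems Suc.IH])
      (use F[OF Suc.prems] in \<open>simp_all add: has_real_derivative_iff_has_vector_derivative\<close>)
  then have "vector_derivative (iter_deriv_on {a..b} p v) (at x within {a..b}) = F (Suc p) x"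
    using vector_derivative_within_cbox[of a b x "iter_deriv_on {a..b} p v"] Suc.prems \<open>a < b\<close>
    by (simp add: cbox_interval)
  then show ?case by (simp add: iter_deriv_on_def)
qed (use v in \<open>simp add: iter_deriv_on_def\<close>)

lemma iter_deriv_on_differentiable:
  fixes F :: "nat \<Rightarrow> real \<Rightarrow> real"
  assumes "a < b" and v: "\<And>x. x \<in> {a..b} \<Longrightarrow> v x = F 0 x"
    and F: "\<And>p x. x \<in> {a..b} \<Longrightarrow> (F p has_real_derivative F (Suc p) x) (at x within {a..b})"
  shows "iter_deriv_on {a..b} p v differentiable_on {a..b}"
  unfolding differentiable_on_def
proof
  fix x assume x: "x \<in> {a..b}"
  have "F p differentiable (at x within {a..b})"
    using F[OF x, of p] by (auto simp: has_field_derivative_def differentiable_def)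
  then show "iter_deriv_on {a..b} p v differentiable (at x within {a..b})"
    by (rule differentiable_transform_within[of _ _ _ 1])
      (use x iter_deriv_on_interval[of a b v F, OF assms] in auto)
qed

section \<open>Assembly of the eigenfunction and of the final statement\<close>

context digits
begin

lemma cf_op_eigenvector_iff:
  assumes "w \<in> cont_space K" "\<And>x. x \<in> K \<Longrightarrow> w x > (0::real)"
  shows "cf_op s w = (\<lambda>x. r * w x) \<longleftrightarrow> eigen s r w"
  using assms by (auto simp: cf_op_def eigen_def cont_space_def fun_eq_iff)

lemma positive_eigenfunction:
  assumes s: "s \<ge> 0"
  shows "\<exists>v :: real \<Rightarrow> real. v \<in> cont_space K \<and> (\<forall>x\<in>K. v x > 0) \<and> cf_op s v = (\<lambda>x. lam s * v x)
    \<and> (\<forall>w \<mu>. w \<in> cont_space K \<and> (\<forall>x\<in>K. w x > 0) \<and> cf_op s w = (\<lambda>x. \<mu> * w x)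
         \<longrightarrow> (\<exists>c>0. w = (\<lambda>x. c * v x)))
    \<and> (\<forall>p. iter_deriv_on K p v differentiable_on K)
    \<and> (\<forall>p\<ge>1. \<forall>x\<in>K.
         (\<Prod>i<p. 2 * s + real i) / (2 / real (Min A) + real (Max A)) ^ p
           \<le> (- 1) ^ p * (iter_deriv_on K p v x / v x)
       \<and> (- 1) ^ p * (iter_deriv_on K p v x / v x)
           \<le> (\<Prod>i<p. 2 * s + real i) / real (Min A) ^ p)"
proof -
  obtain F where e: "eigen s (lam s) (F 0)"
    and F: "\<And>p x. x \<in> K \<Longrightarrow> (F p has_real_derivative F (Suc p) x) (at x within K)"
    and low: "\<And>p x. x \<in> K \<Longrightarrow>
      (\<Prod>i<p. 2 * s + real i) / (2 / real (Min A) + real (Max A)) ^ p * F 0 x \<le> (- 1) ^ p * F p x"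
    and up: "\<And>p x. x \<in> K \<Longrightarrow> (- 1) ^ p * F p x \<le> (\<Prod>i<p. 2 * s + real i) / real (Min A) ^ p * F 0 x"
    by (rule eigenfunction_lam[OF s]) (rule that)
  \<comment> \<open>Cutting off outside \<open>K\<close> turns \<open>F 0\<close> into a
    representative in \<open>cont_space K\<close> and leaves derivatives within \<open>K\<close>
    unchanged.\<close>
  define v where "v = (\<lambda>x. if x \<in> K then F 0 x else 0)"
  have vF: "v x = F 0 x" if "x \<in> K" for x using that by (simp add: v_def)
  have pos: "v x > 0" if "x \<in> K" for x using e that by (simp add: v_def eigen_def)
  have "continuous_on K (F 0)" using e by (simp add: eigen_def)
  then have "continuous_on K v" by (rule continuous_on_eq) (simp add: v_def)
  then have vc: "v \<in> cont_space K" by (simp add: cont_space_def v_def)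
  have ev: "eigen s (lam s) v"
    using e \<open>continuous_on K v\<close> theta_in_K by (auto simp: eigen_def v_def)
  have K01: "0 < 1 / real (Min A)" using Min_ge_1 by simp
  have iter: "iter_deriv_on K p v x = F p x" if "x \<in> K" for p x
    using iter_deriv_on_interval[OF K01, of v F x p] vF F that unfolding K_def by blast
  have diff: "iter_deriv_on K p v differentiable_on K" for p
    using iter_deriv_on_differentiable[OF K01, of v F p] vF F unfolding K_def by blast
  have uniq: "\<exists>c>0. w = (\<lambda>x. c * v x)"
    if w: "w \<in> cont_space K" "\<forall>x\<in>K. w x > 0" "cf_op s w = (\<lambda>x. \<mu> * w x)" for w \<mu>
  proof -
    have "eigen s \<mu> w" using w cf_op_eigenvector_iff[OF w(1), of s \<mu>] by blast
    then obtain c where c: "c > 0" "\<forall>x\<in>K. w x = c * v x" using eigen_unique[OF ev] by blast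
    have "w = (\<lambda>x. c * v x)"
    proof
      fix x
      show "w x = c * v x" using c w(1) by (cases "x \<in> K") (auto simp: v_def cont_space_def)
    qed
    then show ?thesis using c by blast
  qed
  have low': "(\<Prod>i<p. 2 * s + real i) / (2 / real (Min A) + real (Max A)) ^ p
      \<le> (- 1) ^ p * (iter_deriv_on K p v x / v x)" if "x \<in> K" for p x
    using low[OF that, of p] pos[OF that] iter[OF that] vF[OF that] by (simp add: le_divide_eq)
  have up': "(- 1) ^ p * (iter_deriv_on K p v x / v x) \<le> (\<Prod>i<p. 2 * s + real i) / real (Min A) ^ p"
    if "x \<in> K" for p x
    using up[OF that, of p] pos[OF that] iter[OF that] vF[OF that] by (simp add: divide_le_eq)
  show ?thesis
    using vc pos cf_op_eigenvector_iff[OF vc pos, of s "lam s"] ev uniq diff low' up' by blast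
qed

end

theorem theorem3p1:
  fixes N :: nat and m :: "nat \<Rightarrow> nat"
  assumes "N \<ge> 1"
    and "inj_on m {1..N}"
    and "\<forall>j\<in>{1..N}. m j > 0"
  shows
    "(\<forall>s\<ge>0. bounded_op (dom_interval N m) (transfer_op N m s :: (real \<Rightarrow> real) \<Rightarrow> real \<Rightarrow> real)
           \<and> bounded_op (dom_interval N m) (transfer_op N m s :: (real \<Rightarrow> complex) \<Rightarrow> real \<Rightarrow> complex))
     \<and> (\<forall>s>0. transfer_radius N m s > 0 \<and>
          (\<exists>v :: real \<Rightarrow> real.
             v \<in> cont_space (dom_interval N m)
           \<and> (\<forall>x\<in>dom_interval N m. v x > 0)
           \<and> transfer_op N m s v = (\<lambda>x. transfer_radius N m s * v x)
           \<and> (\<forall>w \<mu>. w \<in> cont_space (dom_interval N m)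
                  \<and> (\<forall>x\<in>dom_interval N m. w x > 0)
                  \<and> transfer_op N m s w = (\<lambda>x. \<mu> * w x)
                \<longrightarrow> (\<exists>c>0. w = (\<lambda>x. c * v x)))
           \<and> (\<forall>p. iter_deriv_on (dom_interval N m) p v differentiable_on dom_interval N m)
           \<and> (\<forall>p\<ge>1. \<forall>x\<in>dom_interval N m.
                (\<Prod>i<p. 2 * s + real i) / (2 / real (gamma_min N m) + real (Gamma_max N m)) ^ p
                  \<le> (- 1) ^ p * (iter_deriv_on (dom_interval N m) p v x / v x)
              \<and> (- 1) ^ p * (iter_deriv_on (dom_interval N m) p v x / v x)
                  \<le> (\<Prod>i<p. 2 * s + real i) / real (gamma_min N m) ^ p)))
     \<and> strict_antimono_on {0..} (transfer_radius N m)
     \<and> continuous_on {0..} (transfer_radius N m)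
     \<and> (\<exists>!E. is_invariant_set N m E)
     \<and> (\<exists>s\<ge>0. hausdorff_dim (invariant_set N m) = ennreal s
            \<and> transfer_radius N m s = 1
            \<and> (\<forall>t\<ge>0. transfer_radius N m t = 1 \<longrightarrow> t = s))"
proof -
  define A where "A = m ` {1..N}"
  interpret digits A
    using assms unfolding A_def by unfold_locales auto
  have dom: "dom_interval N m = K"
    by (simp only: dom_interval_def K_def gamma_min_def A_def[symmetric])
  have op: "(transfer_op N m s :: (real \<Rightarrow> 'a::real_normed_field) \<Rightarrow> real \<Rightarrow> 'a) = cf_op s" for s
  proof (intro ext)
    fix w :: "real \<Rightarrow> 'a" and x
    show "transfer_op N m s w x = cf_op s w x"
    proof (cases "x \<in> K")
      case True
      then have "cf_op s w x = (\<Sum>a\<in>A. ((x + real a) powr (- 2 * s)) *\<^sub>R w (theta a x))"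
        by (simp add: cf_op_def)
      \<comment> \<open>Distinctness of the digits is what turns the sum over the set
        \<open>A\<close> into the sum over indices.\<close>
      also have "\<dots> = (\<Sum>j=1..N. ((x + real (m j)) powr (- 2 * s)) *\<^sub>R w (theta (m j) x))"
        unfolding A_def using assms(2) by (simp add: sum.reindex)
      also have "\<dots> = transfer_op N m s w x"
        using transfer_op_explicit[OF assms(3), of x s w] True by (simp add: dom theta_def)
      finally show ?thesis by simp
    qed (simp add: transfer_op_def cf_op_def dom)
  qed
  have rad: "transfer_radius N m = lam"
    by (simp add: fun_eq_iff transfer_radius_def lam_def dom op)
  have inv: "is_invariant_set N m = inv_set"
  proof (rule ext)
    fix E
    have "(\<Union>a\<in>A. theta a ` E) = (\<Union>j\<in>{1..N}. theta (m j) ` E)" by (simp add: A_def)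
    then show "is_invariant_set N m E = inv_set E"
      by (simp only: is_invariant_set_def inv_set_def)
  qed
  have ex1: "\<exists>!E. is_invariant_set N m E" unfolding inv by (rule inv_set_ex1)
  then have E: "inv_set (invariant_set N m)"
    unfolding invariant_set_def inv by (rule theI')
  have bounded: "bounded_op (dom_interval N m) (transfer_op N m s :: (real \<Rightarrow> real) \<Rightarrow> real \<Rightarrow> real)"
    "bounded_op (dom_interval N m) (transfer_op N m s :: (real \<Rightarrow> complex) \<Rightarrow> real \<Rightarrow> complex)"
    if "s \<ge> 0" for s
    unfolding dom op by (rule bounded_op_cf_op[OF that])+
  have anti: "strict_antimono_on {0..} (transfer_radius N m)"
    unfolding rad using lam_strict by (auto simp: monotone_on_def)
  have cont: "continuous_on {0..} (transfer_radius N m)"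
    unfolding rad by (rule lam_continuous)
  obtain s where s: "s \<ge> 0" "lam s = 1" using lam_eq_1 by blast
  have "t = s" if "t \<ge> 0" "lam t = 1" for t
    using lam_strict[of s t] lam_strict[of t s] s that by linarith
  then have dim: "\<exists>s\<ge>0. hausdorff_dim (invariant_set N m) = ennreal s \<and> transfer_radius N m s = 1
      \<and> (\<forall>t\<ge>0. transfer_radius N m t = 1 \<longrightarrow> t = s)"
    using hausdorff_dim_inv_set[OF E s] s unfolding rad by blast
  show ?thesis
    using bounded anti cont ex1 dim positive_eigenfunction lam_pos
    unfolding dom op rad gamma_min_def Gamma_max_def A_def[symmetric] by simp
qed

end
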